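(* Let $\rho,\sigma\in\mathbb{M}_m^+$ with $\rho\ne0$. (i) Assume $\rho^0$ and $\sigma^0$ are not orthogonal. Then for every $z>0$ the function $\alpha\mapsto Q_{\alpha,z}(\rho\|\sigma)$ is log-convex on $[0,\infty)$: for all $\alpha_1,\alpha_2\in[0,\infty)$ and $0<\theta<1$, \[ Q_{\theta\alpha_1+(1-\theta)\alpha_2,z}(\rho\|\sigma)\le Q_{\alpha_1,z}(\rho\|\sigma)^\theta\,Q_{\alpha_2,z}(\rho\|\sigma)^{1-\theta}, \] with the convention $(+\infty)^\theta:=+\infty$. (ii) For every $z>0$ the function $\alpha\mapsto D_{\alpha,z}(\rho\|\sigma)$ is monotone increasing on $[0,\infty)$ (where $D_{1,z}:=D_1$). In particular, for all $\alpha\in[0,1)$ and $\alpha'\in(1,\infty)$, \[ D_{\alpha,z}(\rho\|\sigma)\le D_1(\rho\|\sigma)\le D_{\alpha',z}(\rho\|\sigma). \]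
   Context: For $\sigma\in\mathbb{M}_m^+$ (positive semidefinite matrices), $\sigma^0$ denotes its support projection; for $t>0$, $\sigma^{-t}:=(\sigma^{-1})^t$ where $\sigma^{-1}$ is the generalized inverse (inverse restricted to the support of $\sigma$). For $\rho,\sigma\in\mathbb{M}_m^+$, $\alpha\ge0$, $z>0$: $Q_{\alpha,z}(\rho\|\sigma):=\mathrm{Tr}\bigl(\rho^{\alpha/2z}\sigma^{(1-\alpha)/z}\rho^{\alpha/2z}\bigr)^z=\mathrm{Tr}\,|\rho^{\alpha/2z}\sigma^{(1-\alpha)/2z}|^{2z}$ if $\alpha\in[0,1]$ or $\rho^0\le\sigma^0$, and $Q_{\alpha,z}(\rho\|\sigma):=+\infty$ if $\alpha>1$ and $\rho^0\not\le\sigma^0$ (powers with exponent $0$ of $\rho$ or $\sigma$ mean support projections). For $\rho\ne0$, $\alpha\ne1$: $D_{\alpha,z}(\rho\|\sigma):=\frac{1}{\alpha-1}\log\frac{Q_{\alpha,z}(\rho\|\sigma)}{\mathrm{Tr}\,\rho}$ (with $\log0=-\infty$, $\log(+\infty)=+\infty$). $D_1(\rho\|\sigma):=D(\rho\|\sigma)/\mathrm{Tr}\,\rho$, where the Umegaki relative entropy is $D(\rho\|\sigma)=\mathrm{Tr}\,\rho(\log\rho-\log\sigma)$ (logarithms taken on supports) if $\rho^0\le\sigma^0$ and $+\infty$ otherwise. *)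

theory Defs
  imports "Jordan_Normal_Form.Schur_Decomposition" "HOL-Library.Extended_Real"
begin

definition mtrace :: "complex mat \<Rightarrow> complex" where
  "mtrace A = (\<Sum>i<dim_row A. A $$ (i,i))"

definition psd :: "nat \<Rightarrow> complex mat \<Rightarrow> bool" where
  "psd m A \<longleftrightarrow> A \<in> carrier_mat m m \<and> mat_adjoint A = A \<and>
     (\<forall>v \<in> carrier_vec m. 0 \<le> Re ((A *\<^sub>v v) \<bullet>c v))"

definition loewner_le :: "nat \<Rightarrow> complex mat \<Rightarrow> complex mat \<Rightarrow> bool" where
  "loewner_le m A B \<longleftrightarrow> psd m (B - A)"

definition spec_decomp :: "complex mat \<Rightarrow> complex mat \<Rightarrow> (nat \<Rightarrow> real) \<Rightarrow> bool" where
  "spec_decomp A U d \<longleftrightarrow> (let m = dim_row A in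
     U \<in> carrier_mat m m \<and> U * mat_adjoint U = 1\<^sub>m m \<and>
     A = U * mat_diag m (\<lambda>i. complex_of_real (d i)) * mat_adjoint U)"

(* functional calculus f(A) for Hermitian A (independent of the chosen decomposition) *)
definition matfun :: "(real \<Rightarrow> real) \<Rightarrow> complex mat \<Rightarrow> complex mat" where
  "matfun f A = (let (U, d) = (SOME (U, d). spec_decomp A U d) in
     U * mat_diag (dim_row A) (\<lambda>i. complex_of_real (f (d i))) * mat_adjoint U)"

(* A^t for PSD A, t real: eigenvalue lam \<mapsto> lam powr t.  Since 0 powr t = 0 and
   lam powr 0 = 1 for lam > 0, this gives: for t > 0 the usual power, for t = 0 the
   support projection, for t < 0 the power of the generalized inverse. *)
definition mpow :: "complex mat \<Rightarrow> real \<Rightarrow> complex mat" where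
  "mpow A t = matfun (\<lambda>lam. lam powr t) A"

definition supp :: "complex mat \<Rightarrow> complex mat" where
  "supp A = mpow A 0"

definition mlog :: "complex mat \<Rightarrow> complex mat" where
  "mlog A = matfun (\<lambda>lam. if lam > 0 then ln lam else 0) A"

definition Qaz :: "nat \<Rightarrow> real \<Rightarrow> real \<Rightarrow> complex mat \<Rightarrow> complex mat \<Rightarrow> ereal" where
  "Qaz m \<alpha> z \<rho> \<sigma> =
     (if \<alpha> \<le> 1 \<or> loewner_le m (supp \<rho>) (supp \<sigma>)
      then ereal (Re (mtrace (mpow (mpow \<rho> (\<alpha> / (2*z)) * mpow \<sigma> ((1 - \<alpha>) / z)
                                    * mpow \<rho> (\<alpha> / (2*z))) z)))
      else \<infinity>)"

definition elog :: "ereal \<Rightarrow> ereal" where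
  "elog x = (if x = \<infinity> then \<infinity> else if x \<le> 0 then -\<infinity> else ereal (ln (real_of_ereal x)))"

definition epowr :: "ereal \<Rightarrow> real \<Rightarrow> ereal" where
  "epowr x \<theta> = (if x = \<infinity> then \<infinity> else ereal (real_of_ereal x powr \<theta>))"

definition umegaki :: "nat \<Rightarrow> complex mat \<Rightarrow> complex mat \<Rightarrow> ereal" where
  "umegaki m \<rho> \<sigma> =
     (if loewner_le m (supp \<rho>) (supp \<sigma>)
      then ereal (Re (mtrace (\<rho> * (mlog \<rho> - mlog \<sigma>))))
      else \<infinity>)"

definition D1 :: "nat \<Rightarrow> complex mat \<Rightarrow> complex mat \<Rightarrow> ereal" where
  "D1 m \<rho> \<sigma> = umegaki m \<rho> \<sigma> / ereal (Re (mtrace \<rho>))"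

definition Daz :: "nat \<Rightarrow> real \<Rightarrow> real \<Rightarrow> complex mat \<Rightarrow> complex mat \<Rightarrow> ereal" where
  "Daz m \<alpha> z \<rho> \<sigma> =
     (if \<alpha> = 1 then D1 m \<rho> \<sigma>
      else ereal (1 / (\<alpha> - 1)) * elog (Qaz m \<alpha> z \<rho> \<sigma> / ereal (Re (mtrace \<rho>))))"

end

theory Submission
  imports "HOL-Analysis.Analysis" Defs
begin

text \<open>
  Everything rests on one inequality: if \<open>Y Z\<^sup>\<dagger>\<close> has the spectrum of \<open>X \<ge> 0\<close>, then
  \<open>(Tr X\<^sup>z)\<^sup>2 \<le> Tr (Y Y\<^sup>\<dagger>)\<^sup>z Tr (Z Z\<^sup>\<dagger>)\<^sup>z\<close> for all \<open>z > 0\<close>. For \<open>z \<ge> 1\<close> it follows by triangularizing \<open>Y Z\<^sup>\<dagger>\<close>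
  unitarily and applying Peierls' inequality; for \<open>z < 1\<close> from
  \<open>|det (1 + t Y Z\<^sup>\<dagger>)|\<^sup>2 \<le> det (1 + t Y Y\<^sup>\<dagger>) det (1 + t Z Z\<^sup>\<dagger>)\<close>, integrated against \<open>t\<^sup>-\<^sup>z\<^sup>-\<^sup>1\<close>.

  With \<open>Y = \<rho>\<^sup>a \<sigma>\<^sup>b\<close> and \<open>Z = \<rho>\<^sup>c \<sigma>\<^sup>d\<close> it gives midpoint log-convexity of \<open>\<alpha> \<mapsto> Q\<^sub>\<alpha>\<^sub>,\<^sub>z\<close>, hence log-convexity, as
  \<open>Q\<close> is locally bounded. It also gives \<open>Q\<^sub>1\<^sub>,\<^sub>z \<le> Tr \<rho>\<close> and \<open>Q\<^sub>\<alpha>\<^sub>,\<^sub>2\<^sub>z \<le> Q\<^sub>\<alpha>\<^sub>,\<^sub>z\<close>. If \<open>\<rho>\<^sup>0 \<le> \<sigma>\<^sup>0\<close>, Jensen's inequality in the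
  eigenbasis of \<open>\<rho>\<close> yields \<open>Q\<^sub>\<alpha>\<^sub>,\<^sub>z \<ge> Tr \<rho> exp ((\<alpha> - 1) D\<^sub>1)\<close> for \<open>z \<ge> 1\<close>, thus for all \<open>z\<close>, which separates
  \<open>D\<^sub>\<alpha>\<^sub>,\<^sub>z\<close> for \<open>\<alpha> < 1\<close> from \<open>\<alpha> > 1\<close> without differentiating \<open>Q\<close>.
\<close>

section \<open>Adjoints and unitary matrices\<close>

notation mat_adjoint ("_\<^sup>\<dagger>" [1000] 999)

lemma adjoint_carrier [simp]: "A \<in> carrier_mat n k \<Longrightarrow> A\<^sup>\<dagger> \<in> carrier_mat k n"
  by (auto simp: mat_adjoint_def mat_of_rows_def)

lemma adjoint_dim [simp]: "dim_row (A\<^sup>\<dagger>) = dim_col A" "dim_col (A\<^sup>\<dagger>) = dim_row A"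
  by (auto simp: mat_adjoint_def mat_of_rows_def)

lemma adjoint_index [simp]:
  fixes A :: "complex mat"
  shows "i < dim_col A \<Longrightarrow> j < dim_row A \<Longrightarrow> A\<^sup>\<dagger> $$ (i,j) = cnj (A $$ (j,i))"
  by (auto simp: mat_adjoint_def mat_of_rows_def)

lemma adjoint_adjoint [simp]: "(A\<^sup>\<dagger>)\<^sup>\<dagger> = (A :: complex mat)"
  by (rule eq_matI) auto

lemma adjoint_one [simp]: "(1\<^sub>m n)\<^sup>\<dagger> = (1\<^sub>m n :: complex mat)"
  by (rule eq_matI) auto

lemma adjoint_zero [simp]: "(0\<^sub>m n k)\<^sup>\<dagger> = (0\<^sub>m k n :: complex mat)"
  by (rule eq_matI) auto

lemma mat_mult_index:
  assumes "A \<in> carrier_mat n k" "B \<in> carrier_mat k l" "i < n" "j < l"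
  shows "(A * B) $$ (i,j) = (\<Sum>p<k. A $$ (i,p) * B $$ (p,j))"
  using assms by (auto simp: scalar_prod_def atLeast0LessThan intro!: sum.cong)

lemma adjoint_mult:
  fixes A :: "complex mat"
  assumes A: "A \<in> carrier_mat n k" and B: "B \<in> carrier_mat k l"
  shows "(A * B)\<^sup>\<dagger> = B\<^sup>\<dagger> * A\<^sup>\<dagger>"
proof (rule eq_matI)
  fix i j assume "i < dim_row (B\<^sup>\<dagger> * A\<^sup>\<dagger>)" "j < dim_col (B\<^sup>\<dagger> * A\<^sup>\<dagger>)"
  then have ij: "i < l" "j < n" using A B by auto
  then show "(A * B)\<^sup>\<dagger> $$ (i,j) = (B\<^sup>\<dagger> * A\<^sup>\<dagger>) $$ (i,j)"
    using A B
    by (subst mat_mult_index[OF adjoint_carrier[OF B] adjoint_carrier[OF A] ij])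
       (auto simp: mat_mult_index[OF A B ij(2,1)] mult.commute intro!: sum.cong)
qed (use A B in auto)

lemma adjoint_smult: "(c \<cdot>\<^sub>m A)\<^sup>\<dagger> = cnj c \<cdot>\<^sub>m (A\<^sup>\<dagger> :: complex mat)"
  by (intro eq_matI) auto

lemma adjoint_mat_diag_real:
  "(mat_diag n (\<lambda>i. complex_of_real (d i)))\<^sup>\<dagger> = mat_diag n (\<lambda>i. complex_of_real (d i))"
  by (intro eq_matI) (auto simp: mat_diag_def)

text \<open>This one-sided condition is the clause used in \<open>spec_decomp\<close>; for square
  matrices it implies the other side, see \<open>unitary_left\<close>.\<close>

definition unitary :: "nat \<Rightarrow> complex mat \<Rightarrow> bool" where
  "unitary n U \<longleftrightarrow> U \<in> carrier_mat n n \<and> U * U\<^sup>\<dagger> = 1\<^sub>m n"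

lemma unitary_carrier: "unitary n U \<Longrightarrow> U \<in> carrier_mat n n"
  by (simp add: unitary_def)

lemma unitary_right: "unitary n U \<Longrightarrow> U * U\<^sup>\<dagger> = 1\<^sub>m n"
  by (simp add: unitary_def)

lemma unitary_left: "unitary n U \<Longrightarrow> U\<^sup>\<dagger> * U = 1\<^sub>m n"
  unfolding unitary_def by (rule mat_mult_left_right_inverse[where n = n]) auto

lemma unitary_adjoint: "unitary n U \<Longrightarrow> unitary n (U\<^sup>\<dagger>)"
  using unitary_left by (auto simp: unitary_def)

lemma unitary_mult:
  assumes U: "unitary n U" and V: "unitary n V"
  shows "unitary n (U * V)"
proof -
  note c [simp] = unitary_carrier[OF U] unitary_carrier[OF V]
  have "(U * V) * (U * V)\<^sup>\<dagger> = U * (V * V\<^sup>\<dagger>) * U\<^sup>\<dagger>"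
    by (simp add: adjoint_mult[of U n n V n] assoc_mult_mat[of _ n n _ n _ n] mult_carrier_mat[of _ n n _ n])
  also have "\<dots> = 1\<^sub>m n"
    using right_mult_one_mat[OF c(1)] by (simp add: unitary_right[OF V] unitary_right[OF U])
  finally show ?thesis by (simp add: unitary_def mult_carrier_mat[of _ n n _ n])
qed

text \<open>These are the diagonal entries of \<open>U * U\<^sup>\<dagger>\<close>. With the column
  version, the squared moduli form a doubly stochastic matrix, which provides the weights when
  Jensen's inequality is applied between two orthonormal bases.\<close>

lemma unitary_row_sum:
  assumes "unitary n U" "j < n"
  shows "(\<Sum>k<n. (cmod (U $$ (j,k)))\<^sup>2) = 1"
proof -
  note c = unitary_carrier[OF assms(1)]
  have "complex_of_real (\<Sum>k<n. (cmod (U $$ (j,k)))\<^sup>2) = (U * U\<^sup>\<dagger>) $$ (j,j)"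
    using c assms(2)
    by (subst mat_mult_index[OF c adjoint_carrier[OF c] assms(2,2)])
       (auto simp: complex_norm_square simp del: of_real_power intro!: sum.cong)
  also have "\<dots> = 1" using assms by (simp add: unitary_right)
  finally show ?thesis by (simp only: of_real_eq_1_iff)
qed

lemma unitary_col_sum:
  assumes "unitary n U" "k < n"
  shows "(\<Sum>j<n. (cmod (U $$ (j,k)))\<^sup>2) = 1"
  using unitary_row_sum[OF unitary_adjoint[OF assms(1)] assms(2)] unitary_carrier[OF assms(1)] assms(2)
  by simp

text \<open>Gram-Schmidt on a basis that begins with \<open>v\<close> keeps \<open>v\<close> in
  first place, and dividing every vector by its norm gives orthonormal columns. The normalisation is
  why the first column is \<open>v\<close> only up to a nonzero scalar.\<close>

lemma unitary_complete:
  fixes v :: "complex vec"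
  assumes v: "v \<in> carrier_vec n" "v \<noteq> 0\<^sub>v n"
  shows "\<exists>W c. unitary n W \<and> c \<noteq> 0 \<and> col W 0 = c \<cdot>\<^sub>v v"
proof -
  interpret cof_vec_space n "TYPE(complex)" .
  define b where "b = basis_completion v"
  define ws where "ws = gram_schmidt n b"
  have n0: "n \<noteq> 0" using v by (metis carrier_vecD eq_vecI index_zero_vec(2) less_nat_zero_code)
  from basis_completion[OF v, folded b_def]
  have dist_b: "distinct b" and indep: "\<not> lin_dep (set b)" and b: "set b \<subseteq> carrier_vec n"
    and hdb: "hd b = v" and len_b: "length b = n" by auto
  from hdb len_b n0 obtain vs where bv: "b = v # vs" by (cases b) auto
  from gram_schmidt_result[OF b dist_b indep refl, folded ws_def]
  have ws: "set ws \<subseteq> carrier_vec n" "corthogonal ws" "length ws = n" by (auto simp: len_b)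
  from gram_schmidt_hd[OF v(1), of vs, folded bv] have hdws: "hd ws = v" unfolding ws_def .
  define N where "N j = sqrt (Re (ws ! j \<bullet>c ws ! j))" for j
  define W where "W = mat n n (\<lambda>(i,j). complex_of_real (1 / N j) * (ws ! j) $ i)"
  have wsj: "ws ! j \<in> carrier_vec n" if "j < n" for j using ws that by auto
  have Nsq: "ws ! j \<bullet>c ws ! j = complex_of_real ((N j)\<^sup>2)" "N j > 0" if j: "j < n" for j
  proof -
    have "ws ! j \<bullet>c ws ! j \<noteq> 0" using corthogonalD[OF ws(2)] j ws(3) by auto
    moreover have "ws ! j \<bullet>c ws ! j \<ge> 0" by (rule conjugate_square_ge_0_vec)
    ultimately have *: "Re (ws ! j \<bullet>c ws ! j) > 0" "Im (ws ! j \<bullet>c ws ! j) = 0"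
      by (auto simp: less_eq_complex_def complex_eq_iff)
    then show "N j > 0" by (simp add: N_def)
    show "ws ! j \<bullet>c ws ! j = complex_of_real ((N j)\<^sup>2)"
      using * by (simp add: N_def complex_eq_iff)
  qed
  have Wc: "W \<in> carrier_mat n n" by (simp add: W_def)
  have "W\<^sup>\<dagger> * W = 1\<^sub>m n"
  proof (rule eq_matI)
    fix i j assume "i < dim_row (1\<^sub>m n :: complex mat)" "j < dim_col (1\<^sub>m n :: complex mat)"
    then have ij: "i < n" "j < n" by auto
    have "(W\<^sup>\<dagger> * W) $$ (i,j) = complex_of_real (1 / N i) * complex_of_real (1 / N j) * (ws ! j \<bullet>c ws ! i)"
      using ij wsj[OF ij(1)] wsj[OF ij(2)] Wc
      by (subst mat_mult_index[OF adjoint_carrier[OF Wc] Wc ij])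
         (auto simp: W_def scalar_prod_def sum_distrib_left atLeast0LessThan mult_ac intro!: sum.cong)
    also have "\<dots> = (if i = j then 1 else 0)"
    proof (cases "i = j")
      case True
      then show ?thesis using Nsq[OF ij(1)] by (simp add: power2_eq_square)
    next
      case False
      then show ?thesis using corthogonalD[OF ws(2), of j i] ij ws(3) by simp
    qed
    finally show "(W\<^sup>\<dagger> * W) $$ (i,j) = 1\<^sub>m n $$ (i,j)" using ij by simp
  qed (use Wc in auto)
  then have "unitary n (W\<^sup>\<dagger>)" using Wc by (simp add: unitary_def)
  then have "unitary n W" using unitary_adjoint by fastforce
  moreover have "col W 0 = complex_of_real (1 / N 0) \<cdot>\<^sub>v v"
  proof (rule eq_vecI)
    have "ws ! 0 = v" using hdws ws(3) n0 by (metis hd_conv_nth list.size(3))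
    then show "col W 0 $ i = (complex_of_real (1 / N 0) \<cdot>\<^sub>v v) $ i"
      if "i < dim_vec (complex_of_real (1 / N 0) \<cdot>\<^sub>v v)" for i
      using that v n0 by (auto simp: W_def)
  qed (use v Wc in auto)
  ultimately show ?thesis using Nsq(2)[of 0] n0
    by (intro exI[of _ W] exI[of _ "complex_of_real (1 / N 0)"]) auto
qed

section \<open>Unitary triangularization\<close>

lemma char_poly_one_dim: "char_poly (mat 1 1 (\<lambda>_. e)) = [:- e, 1:]"
  by (simp add: char_poly_defs det_def sign_def)

lemma adjoint_four_block:
  fixes A :: "complex mat"
  assumes "A \<in> carrier_mat a b" "B \<in> carrier_mat a d" "C \<in> carrier_mat c b" "D \<in> carrier_mat c d"
  shows "(four_block_mat A B C D)\<^sup>\<dagger> = four_block_mat (A\<^sup>\<dagger>) (C\<^sup>\<dagger>) (B\<^sup>\<dagger>) (D\<^sup>\<dagger>)"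
  using assms by (intro eq_matI) auto

lemma block_diag_mult_left:
  fixes V :: "'a :: ring_1 mat"
  assumes V: "V \<in> carrier_mat k k" and A: "A \<in> carrier_mat r r" and B: "B \<in> carrier_mat r k"
    and D: "D \<in> carrier_mat k k"
  shows "four_block_mat (1\<^sub>m r) (0\<^sub>m r k) (0\<^sub>m k r) V * four_block_mat A B (0\<^sub>m k r) D
    = four_block_mat A B (0\<^sub>m k r) (V * D)"
  unfolding mult_four_block_mat[OF one_carrier_mat zero_carrier_mat zero_carrier_mat V A B zero_carrier_mat D]
  using right_mult_zero_mat[OF V, of r] left_mult_zero_mat[OF A, of k] left_mult_zero_mat[OF B, of k]
    left_mult_zero_mat[OF D, of r] left_mult_one_mat[OF A] left_mult_one_mat[OF B]
    left_add_zero_mat[OF mult_carrier_mat[OF V D]] right_add_zero_mat[OF A] right_add_zero_mat[OF B]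
    left_add_zero_mat[OF zero_carrier_mat[of k r]] left_mult_zero_mat[OF zero_carrier_mat[of k r], of r]
  by simp

lemma block_diag_mult_right:
  fixes V :: "'a :: ring_1 mat"
  assumes V: "V \<in> carrier_mat k k" and A: "A \<in> carrier_mat r r" and B: "B \<in> carrier_mat r k"
    and D: "D \<in> carrier_mat k k"
  shows "four_block_mat A B (0\<^sub>m k r) D * four_block_mat (1\<^sub>m r) (0\<^sub>m r k) (0\<^sub>m k r) V
    = four_block_mat A (B * V) (0\<^sub>m k r) (D * V)"
  unfolding mult_four_block_mat[OF A B zero_carrier_mat D one_carrier_mat zero_carrier_mat zero_carrier_mat V]
  using right_mult_zero_mat[OF A, of k] right_mult_zero_mat[OF B, of r] right_mult_zero_mat[OF D, of r]
    right_mult_one_mat[OF A] right_add_zero_mat[OF A] left_add_zero_mat[OF mult_carrier_mat[OF B V]]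
    left_add_zero_mat[OF mult_carrier_mat[OF D V]] left_add_zero_mat[OF zero_carrier_mat[of k r]]
    right_mult_one_mat[OF zero_carrier_mat[of k r]] left_mult_zero_mat[OF zero_carrier_mat[of r k], of k]
  by simp

lemma conj_conj:
  fixes W :: "complex mat"
  assumes [simp]: "W \<in> carrier_mat n n" "P \<in> carrier_mat n n" "S \<in> carrier_mat n n"
  shows "W * (P * S * P\<^sup>\<dagger>) * W\<^sup>\<dagger> = (W * P) * S * (W * P)\<^sup>\<dagger>"
  by (simp add: adjoint_mult[of W n n P n] assoc_mult_mat[of _ n n _ n _ n] mult_carrier_mat[of _ n n _ n])

text \<open>Induction by deflation: an eigenvector for the head of \<open>es\<close> is completed to
  a unitary \<open>W\<close>, and the induction hypothesis triangularizes the remaining block. The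
  diagonal appears in the order of \<open>es\<close>, so later proofs can prescribe which eigenvalue
  stands where.\<close>

theorem unitary_schur:
  fixes A :: "complex mat"
  assumes "A \<in> carrier_mat n n" "char_poly A = (\<Prod>e\<leftarrow>es. [:- e, 1:])"
  shows "\<exists>V T. unitary n V \<and> T \<in> carrier_mat n n \<and> upper_triangular T \<and> diag_mat T = es
           \<and> A = V * T * V\<^sup>\<dagger>"
  using assms
proof (induction es arbitrary: n A)
  case Nil
  then have "n = 0" using degree_monic_char_poly[of A n] by simp
  with Nil show ?case
    by (intro exI[of _ "1\<^sub>m n"] exI[of _ A]) (auto simp: unitary_def diag_mat_def intro!: eq_matI)
next
  case (Cons e es n A)
  note A = Cons.prems(1)
  define k where "k = n - 1"
  have ev: "eigenvalue A e"
    using Cons.prems(2) by (simp add: eigenvalue_root_char_poly[OF A])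
  then obtain v where v: "v \<in> carrier_vec n" "v \<noteq> 0\<^sub>v n" "A *\<^sub>v v = e \<cdot>\<^sub>v v"
    using A by (auto simp: eigenvalue_def eigenvector_def)
  have n: "n = Suc k" using v(1,2) by (cases n) (auto simp: k_def)
  obtain W c where W: "unitary n W" and Wc: "c \<noteq> 0" "col W 0 = c \<cdot>\<^sub>v v"
    using unitary_complete[OF v(1,2)] by blast
  note WC [simp] = unitary_carrier[OF W]
  define B where "B = W\<^sup>\<dagger> * A * W"
  have BC: "B \<in> carrier_mat n n" unfolding B_def using A by (auto intro!: mult_carrier_mat[of _ n n])
  have "A = (W * W\<^sup>\<dagger>) * A * (W * W\<^sup>\<dagger>)" using A by (simp add: unitary_right[OF W])
  also have "\<dots> = W * B * W\<^sup>\<dagger>" unfolding B_def using A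
    by (simp add: assoc_mult_mat[of _ n n _ n _ n] mult_carrier_mat[of _ n n _ n])
  finally have AB: "A = W * B * W\<^sup>\<dagger>" .
  have "col (A * W) 0 = A *\<^sub>v col W 0" using A n WC by (metis col_mult2 zero_less_Suc)
  also have "\<dots> = e \<cdot>\<^sub>v col W 0"
    unfolding Wc(2) using v A by (simp add: mult_mat_vec[of A n n] smult_smult_assoc mult.commute)
  finally have AW0: "col (A * W) 0 = e \<cdot>\<^sub>v col W 0" .
  \<comment> \<open>Column 0 of \<open>W\<close> is an eigenvector of \<open>A\<close>, and
    orthonormality of the columns of \<open>W\<close> turns it into the first unit vector.\<close>
  have B0: "B $$ (i,0) = (if i = 0 then e else 0)" if "i < n" for i
  proof -
    have "B $$ (i,0) = (W\<^sup>\<dagger> * (A * W)) $$ (i,0)" unfolding B_def using A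
      by (simp add: assoc_mult_mat[of _ n n _ n _ n])
    also have "\<dots> = row (W\<^sup>\<dagger>) i \<bullet> col (A * W) 0" using that A n WC by simp
    also have "\<dots> = e * (row (W\<^sup>\<dagger>) i \<bullet> col W 0)"
      unfolding AW0 
      by (rule scalar_prod_smult_distrib[of _ n]; rule carrier_vecI; use carrier_matD[OF WC] in simp)
    also have "row (W\<^sup>\<dagger>) i \<bullet> col W 0 = (W\<^sup>\<dagger> * W) $$ (i,0)" using that n WC by simp
    finally show ?thesis using that n by (simp add: unitary_left[OF W])
  qed
  obtain B1 B2 B0' B3 where split: "split_block B 1 1 = (B1,B2,B0',B3)"
    by (cases "split_block B 1 1", auto)
  have "dim_row B = 1 + k" "dim_col B = 1 + k" using BC n by auto
  from split_block[OF split this] have B1: "B1 \<in> carrier_mat 1 1" and B2: "B2 \<in> carrier_mat 1 k"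
    and B0': "B0' \<in> carrier_mat k 1" and B3: "B3 \<in> carrier_mat k k"
    and Bb: "B = four_block_mat B1 B2 B0' B3" by auto
  have B1id: "B1 = mat 1 1 (\<lambda>_. e)"
    using B0[of 0] n B1 unfolding Bb by (intro eq_matI) auto
  have B0id: "B0' = 0\<^sub>m k 1"
  proof (rule eq_matI)
    fix i j assume "i < dim_row (0\<^sub>m k 1 :: complex mat)" "j < dim_col (0\<^sub>m k 1 :: complex mat)"
    then show "B0' $$ (i,j) = 0\<^sub>m k 1 $$ (i,j)"
      using B0[of "Suc i"] n B0' B1 B3 unfolding Bb by simp
  qed (use B0' in auto)
  have "similar_mat A B"
    unfolding similar_mat_def
    by (intro exI[of _ W] exI[of _ "W\<^sup>\<dagger>"] similar_mat_witI[of _ _ n])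
       (use A BC AB in \<open>auto simp: unitary_left[OF W] unitary_right[OF W]\<close>)
  then have "char_poly B = [:- e, 1:] * (\<Prod>e\<leftarrow>es. [:- e, 1:])"
    using char_poly_similar Cons.prems(2) by fastforce
  also have "char_poly B = [:- e, 1:] * char_poly B3"
    using char_poly_four_block_zeros_col[OF B1 B2 B3] char_poly_one_dim[of e]
    by (simp only: Bb B0id B1id)
  finally have "char_poly B3 = (\<Prod>e\<leftarrow>es. [:- e, 1:])"
    by (metis mult_cancel_left pCons_eq_0_iff zero_neq_one)
  from Cons.IH[OF B3 this] obtain V T where V: "unitary k V" and T: "T \<in> carrier_mat k k"
      "upper_triangular T" "diag_mat T = es" "B3 = V * T * V\<^sup>\<dagger>" by blast
  note VC [simp] = unitary_carrier[OF V]
  \<comment> \<open>\<open>?P\<close> fixes the first basis vector and lets \<open>V\<close> act on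
    its orthogonal complement, so conjugation by it leaves the first column of the block form
    intact.\<close>
  let ?P = "four_block_mat (1\<^sub>m 1) (0\<^sub>m 1 k) (0\<^sub>m k 1) V"
  let ?S = "four_block_mat B1 (B2 * V) (0\<^sub>m k 1) T"
  have PC: "?P \<in> carrier_mat n n" using four_block_carrier_mat[OF one_carrier_mat[of 1] VC] by (simp add: n)
  have SC: "?S \<in> carrier_mat n n" using four_block_carrier_mat[OF B1 T(1)] by (simp add: n)
  have Pad: "?P\<^sup>\<dagger> = four_block_mat (1\<^sub>m 1) (0\<^sub>m 1 k) (0\<^sub>m k 1) (V\<^sup>\<dagger>)"
    using VC by (subst adjoint_four_block[of _ 1 1 _ k _ k]) auto
  have "?P * ?P\<^sup>\<dagger> = 1\<^sub>m n"
    unfolding Pad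
    using block_diag_mult_left[OF VC one_carrier_mat zero_carrier_mat adjoint_carrier[OF VC]]
      four_block_one_mat[of 1 k]
    by (simp add: unitary_right[OF V] n)
  then have P: "unitary n ?P" using PC by (simp add: unitary_def)
  have "?P * ?S * ?P\<^sup>\<dagger> = B"
  proof -
    have "?P * ?S = four_block_mat B1 (B2 * V) (0\<^sub>m k 1) (V * T)"
      by (rule block_diag_mult_left[OF VC B1 mult_carrier_mat[OF B2 VC] T(1)])
    also have "\<dots> * ?P\<^sup>\<dagger> = four_block_mat B1 (B2 * V * V\<^sup>\<dagger>) (0\<^sub>m k 1) (V * T * V\<^sup>\<dagger>)"
      unfolding Pad
      by (rule block_diag_mult_right[OF adjoint_carrier[OF VC] B1 mult_carrier_mat[OF B2 VC]
            mult_carrier_mat[OF VC T(1)]])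
    also have "B2 * V * V\<^sup>\<dagger> = B2"
      using B2 by (simp add: assoc_mult_mat[OF B2 VC adjoint_carrier[OF VC]] unitary_right[OF V])
    finally show ?thesis unfolding Bb B0id T(4) .
  qed
  then have "A = (W * ?P) * ?S * (W * ?P)\<^sup>\<dagger>"
    using AB conj_conj[OF WC PC SC] by metis
  moreover have "upper_triangular ?S"
    by (rule upper_triangular_four_block[OF B1 T(1) _ T(2)]) (auto simp: B1id)
  moreover have "diag_mat ?S = e # es"
    unfolding diag_four_block_mat[OF B1 T(1)] T(3) by (simp add: B1id diag_mat_def)
  ultimately show ?case using unitary_mult[OF W P] SC by blast
qed

text \<open>\<open>proots\<close> recovers the list of roots up to order from the product of linear
  factors.\<close>

lemma char_poly_prod_list_eq_mset:
  fixes as bs :: "complex list"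
  assumes "(\<Prod>a\<leftarrow>as. [:- a, 1:]) = (\<Prod>b\<leftarrow>bs. [:- b, 1:])"
  shows "mset as = mset bs"
proof -
  have "proots (\<Prod>a\<leftarrow>as. [:- a, 1:]) = mset as" for as :: "complex list"
  proof (induction as)
    case (Cons a as)
    have "(\<Prod>a\<leftarrow>as. [:- a, 1:]) \<noteq> 0" by (auto simp: prod_list_zero_iff)
    then show ?case using Cons by (simp add: proots_mult del: mult_pCons_left)
  qed simp
  then show ?thesis using assms by metis
qed

text \<open>The block matrix with diagonal blocks \<open>?X\<close>, \<open>1\<^sub>m n\<close> and
  off-diagonal blocks \<open>?l A\<close>, \<open>?l B\<close> has determinant
  \<open>char_poly (A * B)\<close>. Exchanging both block rows and block columns gives the matrix
  for \<open>B * A\<close>, and the two signs cancel. No invertibility is involved.\<close>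

lemma char_poly_mult_commute:
  fixes A :: "'a :: idom mat"
  assumes A: "A \<in> carrier_mat n n" and B: "B \<in> carrier_mat n n"
  shows "char_poly (A * B) = char_poly (B * A)"
proof -
  interpret h: comm_ring_hom "\<lambda>x :: 'a. [:x:]" by unfold_locales (auto simp: one_pCons)
  let ?l = "map_mat (\<lambda>x :: 'a. [:x:])"
  let ?X = "[:0, 1:] \<cdot>\<^sub>m 1\<^sub>m n :: 'a poly mat"
  have c: "?l A \<in> carrier_mat n n" "?l B \<in> carrier_mat n n" "?X \<in> carrier_mat n n"
    "(1\<^sub>m n :: 'a poly mat) \<in> carrier_mat n n"
    using A B by auto
  have cp: "char_poly (C * D) = det (?X - ?l C * ?l D)" if "C \<in> carrier_mat n n" "D \<in> carrier_mat n n" for C D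
  proof -
    have "char_poly_matrix (C * D) = ?X + - ?l (C * D)"
      using that by (intro eq_matI) (auto simp: char_poly_matrix_def)
    also have "\<dots> = ?X - ?l C * ?l D"
      using that by (simp add: h.mat_hom_mult[of C n n D n] minus_add_uminus_mat[of _ n n] mult_carrier_mat[of _ n n _ n])
    finally show ?thesis by (simp add: char_poly_def)
  qed
  \<comment> \<open>The block determinant formula asks the two lower blocks to commute; for the
    exchanged matrix these are \<open>?l A\<close> and \<open>?X\<close>.\<close>
  have comm: "?X * ?l A = ?l A * ?X" using c(1) by (intro eq_matI) (auto simp: mult.commute)
  have "det (four_block_mat ?X (?l A) (?l B) (1\<^sub>m n)) = char_poly (A * B)"
    using c by (subst det_four_block_mat[of _ n]) (auto simp: cp[OF A B])
  moreover have "det (four_block_mat (1\<^sub>m n) (?l B) (?l A) ?X) = char_poly (B * A)"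
    using c comm by (subst det_four_block_mat[of _ n]) (auto simp: cp[OF B A])
  moreover have "det (four_block_mat ?X (?l A) (?l B) (1\<^sub>m n)) = det (four_block_mat (1\<^sub>m n) (?l B) (?l A) ?X)"
    (is "det ?F = det ?G")
  proof -
    let ?H = "mat (n + n) (n + n) (\<lambda>(i,j). ?F $$ ((if i < n then i + n else i - n), j))"
    have "det ?F = (-1)^(n * n) * det ?H"
      by (rule det_swap_rows) (use c in simp)
    also have "det ?H = (-1)^(n * n) * det (mat (n + n) (n + n)
        (\<lambda>(i,j). ?H $$ (i, (if j < n then j + n else j - n))))"
      by (rule det_swap_cols) simp
    also have "mat (n + n) (n + n) (\<lambda>(i,j). ?H $$ (i, (if j < n then j + n else j - n))) = ?G"
      using A B by (intro eq_matI) auto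
    finally show ?thesis by (simp flip: mult.assoc power_add) 
  qed
  ultimately show ?thesis by simp
qed

section \<open>Spectral decomposition\<close>

lemma adjoint_inner:
  fixes C :: "complex mat"
  assumes C: "C \<in> carrier_mat n k" and w: "w \<in> carrier_vec n" and v: "v \<in> carrier_vec k"
  shows "(C\<^sup>\<dagger> *\<^sub>v w) \<bullet>c v = w \<bullet>c (C *\<^sub>v v)"
proof -
  have "(C\<^sup>\<dagger> *\<^sub>v w) \<bullet>c v = (\<Sum>i<k. \<Sum>p<n. cnj (C $$ (p,i)) * w $ p * cnj (v $ i))"
    using assms by (auto simp: scalar_prod_def atLeast0LessThan sum_distrib_right intro!: sum.cong)
  also have "\<dots> = (\<Sum>p<n. \<Sum>i<k. cnj (C $$ (p,i)) * w $ p * cnj (v $ i))"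
    by (rule sum.swap)
  also have "\<dots> = w \<bullet>c (C *\<^sub>v v)"
    using assms by (auto simp: scalar_prod_def atLeast0LessThan sum_distrib_left mult_ac intro!: sum.cong)
  finally show ?thesis .
qed

section \<open>Positive semidefinite matrices and congruence\<close>

lemma psd_carrier: "psd n A \<Longrightarrow> A \<in> carrier_mat n n"
  by (simp add: psd_def)

lemma psd_adjoint: "psd n A \<Longrightarrow> A\<^sup>\<dagger> = A"
  by (simp add: psd_def)

lemma psd_congruence:
  assumes A: "psd n A" and C: "C \<in> carrier_mat n n"
  shows "psd n (C\<^sup>\<dagger> * A * C)"
  unfolding psd_def
proof (intro conjI ballI)
  note Ac [simp] = psd_carrier[OF A] and C [simp]
  show "C\<^sup>\<dagger> * A * C \<in> carrier_mat n n" by (simp add: mult_carrier_mat[of _ n n _ n])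
  show "(C\<^sup>\<dagger> * A * C)\<^sup>\<dagger> = C\<^sup>\<dagger> * A * C"
    by (simp add: adjoint_mult[of _ n n _ n] mult_carrier_mat[of _ n n _ n] psd_adjoint[OF A]
        assoc_mult_mat[of _ n n _ n _ n])
  fix v :: "complex vec" assume v: "v \<in> carrier_vec n"
  have "(C\<^sup>\<dagger> * A * C) *\<^sub>v v = C\<^sup>\<dagger> *\<^sub>v (A *\<^sub>v (C *\<^sub>v v))"
    using v by (simp add: assoc_mult_mat_vec[of _ n n _ n] mult_carrier_mat[of _ n n _ n]
        mult_mat_vec_carrier[of _ n n])
  then have "((C\<^sup>\<dagger> * A * C) *\<^sub>v v) \<bullet>c v = (A *\<^sub>v (C *\<^sub>v v)) \<bullet>c (C *\<^sub>v v)"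
    using v by (simp add: adjoint_inner[OF C _ v] mult_mat_vec_carrier[of _ n n])
  moreover have "C *\<^sub>v v \<in> carrier_vec n" using v by (simp add: mult_mat_vec_carrier[of _ n n])
  ultimately show "0 \<le> Re (((C\<^sup>\<dagger> * A * C) *\<^sub>v v) \<bullet>c v)"
    using A by (simp add: psd_def)
qed

lemma psd_mat_diag:
  assumes "\<And>i. i < n \<Longrightarrow> 0 \<le> d i"
  shows "psd n (mat_diag n (\<lambda>i. complex_of_real (d i)))"
  unfolding psd_def
proof (intro conjI ballI)
  fix v :: "complex vec" assume v: "v \<in> carrier_vec n"
  have "(mat_diag n (\<lambda>i. complex_of_real (d i)) *\<^sub>v v) $ i = complex_of_real (d i) * v $ i" if "i < n" for i
    using that v by (simp add: scalar_prod_def mat_diag_def mult_delta_left)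
  then have "(mat_diag n (\<lambda>i. complex_of_real (d i)) *\<^sub>v v) \<bullet>c v
      = (\<Sum>i\<in>{0..<n}. complex_of_real (d i) * (v $ i * cnj (v $ i)))"
    using v by (auto simp: scalar_prod_def mult.assoc intro!: sum.cong)
  also have "\<dots> = complex_of_real (\<Sum>i\<in>{0..<n}. d i * (cmod (v $ i))\<^sup>2)"
    by (simp only: complex_norm_square[symmetric] of_real_sum of_real_mult)
  finally show "0 \<le> Re ((mat_diag n (\<lambda>i. complex_of_real (d i)) *\<^sub>v v) \<bullet>c v)"
    using assms by (auto intro!: sum_nonneg)
qed (auto simp: adjoint_mat_diag_real)

lemma psd_one: "psd n (1\<^sub>m n)"
  using psd_mat_diag[of n "\<lambda>_. 1"] by simp

lemma psd_mult_adjoint: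
  assumes Y: "Y \<in> carrier_mat n n"
  shows "psd n (Y * Y\<^sup>\<dagger>)"
  using psd_congruence[OF psd_one adjoint_carrier[OF Y]] Y by simp

text \<open>All functions of one matrix share the same \<open>U\<close>, so with \<open>U\<close>
  fixed, products, sums and traces become pointwise operations on \<open>d\<close>. Only the values
  of \<open>d\<close> below \<open>n\<close> matter, see \<open>wdiag_cong\<close>.\<close>

definition wdiag :: "nat \<Rightarrow> complex mat \<Rightarrow> (nat \<Rightarrow> real) \<Rightarrow> complex mat" where
  "wdiag n U d = U * mat_diag n (\<lambda>i. complex_of_real (d i)) * U\<^sup>\<dagger>"

lemma wdiag_carrier [simp]: "U \<in> carrier_mat n n \<Longrightarrow> wdiag n U d \<in> carrier_mat n n"
  by (simp add: wdiag_def mult_carrier_mat[of _ n n _ n])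

lemma wdiag_cong: "(\<And>i. i < n \<Longrightarrow> d i = e i) \<Longrightarrow> wdiag n U d = wdiag n U e"
  unfolding wdiag_def mat_diag_def
  by (rule arg_cong[where f = "\<lambda>M. U * M * U\<^sup>\<dagger>"]) (auto intro!: eq_matI)

lemma wdiag_adjoint:
  assumes "U \<in> carrier_mat n n"
  shows "(wdiag n U d)\<^sup>\<dagger> = wdiag n U d"
  using assms unfolding wdiag_def
  by (simp add: adjoint_mult[of _ n n _ n] mult_carrier_mat[of _ n n _ n] adjoint_mat_diag_real
      assoc_mult_mat[of _ n n _ n _ n])

lemma wdiag_index:
  assumes U: "U \<in> carrier_mat n n" and ij: "i < n" "j < n"
  shows "wdiag n U d $$ (i,j) = (\<Sum>k<n. complex_of_real (d k) * (U $$ (i,k) * cnj (U $$ (j,k))))"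
  unfolding wdiag_def mat_diag_mult_right[OF U] using assms
  by (subst mat_mult_index[of _ n n _ n]) (auto intro!: sum.cong)

lemma wdiag_mult:
  assumes U: "unitary n U"
  shows "wdiag n U d * wdiag n U e = wdiag n U (\<lambda>i. d i * e i)"
proof -
  let ?D = "mat_diag n (\<lambda>i. complex_of_real (d i))" and ?E = "mat_diag n (\<lambda>i. complex_of_real (e i))"
  note [simp] = unitary_carrier[OF U]
  have "wdiag n U d * wdiag n U e = U * ?D * (U\<^sup>\<dagger> * U) * ?E * U\<^sup>\<dagger>"
    unfolding wdiag_def
    by (simp add: assoc_mult_mat[of _ n n _ n _ n] mult_carrier_mat[of _ n n _ n])
  also have "\<dots> = U * (?D * ?E) * U\<^sup>\<dagger>"
    unfolding unitary_left[OF U] by (simp add: assoc_mult_mat[of _ n n _ n _ n] mult_carrier_mat[of _ n n _ n]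
        left_mult_one_mat[of _ n n] del: mat_diag_diag)
  finally show ?thesis by (simp add: wdiag_def)
qed

lemma wdiag_one:
  assumes "unitary n U" "\<And>i. i < n \<Longrightarrow> d i = 1"
  shows "wdiag n U d = 1\<^sub>m n"
proof -
  have "wdiag n U d = wdiag n U (\<lambda>_. 1)" by (rule wdiag_cong) (rule assms)
  then show ?thesis using right_mult_one_mat[OF unitary_carrier[OF assms(1)]] assms(1)
    by (simp add: wdiag_def unitary_right)
qed

lemma wdiag_psd:
  assumes "unitary n U" "\<And>i. i < n \<Longrightarrow> 0 \<le> d i"
  shows "psd n (wdiag n U d)"
  using psd_congruence[OF psd_mat_diag[OF assms(2)] adjoint_carrier[OF unitary_carrier[OF assms(1)]]]
  by (simp add: wdiag_def)

lemma mtrace_mult_commute: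
  assumes A: "A \<in> carrier_mat n n" and B: "B \<in> carrier_mat n n"
  shows "mtrace (A * B) = mtrace (B * A)"
proof -
  have "mtrace (A * B) = (\<Sum>i<n. \<Sum>j<n. A $$ (i,j) * B $$ (j,i))"
    unfolding mtrace_def using A B
    by (intro sum.cong) (auto simp: scalar_prod_def atLeast0LessThan)
  also have "\<dots> = (\<Sum>j<n. \<Sum>i<n. A $$ (i,j) * B $$ (j,i))" by (rule sum.swap)
  also have "\<dots> = mtrace (B * A)"
    unfolding mtrace_def using A B
    by (intro sum.cong) (auto simp: scalar_prod_def atLeast0LessThan mult.commute)
  finally show ?thesis .
qed

lemma mtrace_wdiag:
  assumes U: "unitary n U"
  shows "mtrace (wdiag n U d) = complex_of_real (\<Sum>i<n. d i)"
proof -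
  note [simp] = unitary_carrier[OF U]
  have "mtrace (wdiag n U d) = mtrace (U\<^sup>\<dagger> * (U * mat_diag n (\<lambda>i. complex_of_real (d i))))"
    unfolding wdiag_def by (rule mtrace_mult_commute[of _ n]) (auto simp: mult_carrier_mat[of _ n n _ n])
  also have "U\<^sup>\<dagger> * (U * mat_diag n (\<lambda>i. complex_of_real (d i))) = mat_diag n (\<lambda>i. complex_of_real (d i))"
    by (simp add: assoc_mult_mat[of _ n n _ n _ n, symmetric] unitary_left[OF U]
        left_mult_one_mat[of _ n n])
  finally show ?thesis by (simp add: mtrace_def mat_diag_def)
qed

lemma unitary_conj_cancel:
  assumes U: "unitary n U" and T: "T \<in> carrier_mat n n" and A: "A = U * T * U\<^sup>\<dagger>"
  shows "U\<^sup>\<dagger> * A * U = T"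
proof -
  note [simp] = unitary_carrier[OF U] T
  have "U\<^sup>\<dagger> * A * U = (U\<^sup>\<dagger> * U) * T * (U\<^sup>\<dagger> * U)"
    unfolding A by (simp add: assoc_mult_mat[of _ n n _ n _ n] mult_carrier_mat[of _ n n _ n])
  then show ?thesis
    by (simp add: unitary_left[OF U] left_mult_one_mat[of _ n n] right_mult_one_mat[of _ n n])
qed

lemma similar_mat_unitary:
  assumes U: "unitary n U" and T: "T \<in> carrier_mat n n"
  shows "similar_mat (U * T * U\<^sup>\<dagger>) T"
  unfolding similar_mat_def
  by (intro exI[of _ U] exI[of _ "U\<^sup>\<dagger>"] similar_mat_witI[of _ _ n])
     (use unitary_carrier[OF U] T in
       \<open>auto simp: unitary_left[OF U] unitary_right[OF U] mult_carrier_mat[of _ n n _ n]\<close>)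

lemma char_poly_wdiag:
  assumes U: "unitary n U"
  shows "char_poly (wdiag n U d) = (\<Prod>a\<leftarrow>map (\<lambda>i. complex_of_real (d i)) [0..<n]. [:- a, 1:])"
proof -
  let ?D = "mat_diag n (\<lambda>i. complex_of_real (d i))"
  have "char_poly (wdiag n U d) = char_poly ?D"
    unfolding wdiag_def by (rule char_poly_similar[OF similar_mat_unitary[OF U]]) simp
  also have "\<dots> = (\<Prod>a\<leftarrow>diag_mat ?D. [:- a, 1:])"
    by (rule char_poly_upper_triangular[of _ n]) (auto simp: mat_diag_def)
  also have "diag_mat ?D = map (\<lambda>i. complex_of_real (d i)) [0..<n]"
    by (auto simp: diag_mat_def mat_diag_def)
  finally show ?thesis .
qed

text \<open>The unitary triangular form of a Hermitian matrix is again Hermitian; being also upper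
  triangular, it is diagonal with real entries.\<close>

theorem psd_spectral:
  assumes A: "psd n A"
  shows "\<exists>U d. unitary n U \<and> A = wdiag n U d"
proof -
  note Ac = psd_carrier[OF A]
  obtain es where "char_poly A = (\<Prod>e\<leftarrow>es. [:- e, 1:])"
    using char_poly_factorized[OF Ac] by blast
  from unitary_schur[OF Ac this] obtain V T where V: "unitary n V" and T: "T \<in> carrier_mat n n"
    "upper_triangular T" and AV: "A = V * T * V\<^sup>\<dagger>" by blast
  note Vc = unitary_carrier[OF V]
  have "T\<^sup>\<dagger> = (V\<^sup>\<dagger> * A * V)\<^sup>\<dagger>" using unitary_conj_cancel[OF V T(1) AV] by simp
  also have "\<dots> = V\<^sup>\<dagger> * A * V"
    using Ac Vc by (simp add: adjoint_mult[of _ n n _ n] mult_carrier_mat[of _ n n _ n] psd_adjoint[OF A]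
        assoc_mult_mat[of _ n n _ n _ n])
  finally have Th: "T\<^sup>\<dagger> = T" using unitary_conj_cancel[OF V T(1) AV] by simp
  have "T $$ (i,j) = (if i = j then complex_of_real (Re (T $$ (j,j))) else 0)" if ij: "i < n" "j < n" for i j
  proof -
    have 1: "T $$ (i,j) = cnj (T $$ (j,i))"
      by (subst Th[symmetric]) (use T(1) ij in simp)
    consider "i = j" | "j < i" | "i < j" by linarith
    then show ?thesis
    proof cases
      case 1
      with \<open>T $$ (i,j) = cnj (T $$ (j,i))\<close> show ?thesis by (simp add: complex_eq_iff)
    next
      case 2
      then show ?thesis using upper_triangularD[OF T(2), of j i] T(1) ij by simp
    next
      case 3
      then show ?thesis using 1 upper_triangularD[OF T(2), of i j] T(1) ij by simp
    qed
  qed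
  then have "T = mat_diag n (\<lambda>i. complex_of_real (Re (T $$ (i,i))))"
    using T(1) by (intro eq_matI) (auto simp: mat_diag_def)
  then show ?thesis using V AV unfolding wdiag_def by metis
qed

lemma spec_decomp_wdiag:
  assumes "A \<in> carrier_mat n n"
  shows "spec_decomp A U d \<longleftrightarrow> unitary n U \<and> A = wdiag n U d"
  using assms by (auto simp: spec_decomp_def unitary_def wdiag_def Let_def)

lemma psd_diag_index_nonneg:
  assumes A: "psd n A" and V: "V \<in> carrier_mat n n" and j: "j < n"
  shows "0 \<le> Re ((V\<^sup>\<dagger> * A * V) $$ (j,j))"
proof -
  note B = psd_congruence[OF A V]
  let ?B = "V\<^sup>\<dagger> * A * V"
  have Bc: "?B \<in> carrier_mat n n" by (rule psd_carrier[OF B])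
  have "?B *\<^sub>v unit_vec n j = col ?B j"
    using j Bc by (intro eq_vecI) (auto simp: scalar_prod_def unit_vec_def mult_delta_right simp del: index_mult_mat)
  then have "(?B *\<^sub>v unit_vec n j) \<bullet>c unit_vec n j = ?B $$ (j,j)"
    using j Bc by (simp add: scalar_prod_def unit_vec_def mult_delta_right if_distrib[of cnj]
        del: index_mult_mat cong: if_cong)
  then show ?thesis using B j unfolding psd_def by (metis unit_vec_carrier)
qed

lemma psd_eigenvalues_nonneg:
  assumes A: "psd n A" and U: "unitary n U" "A = wdiag n U d" and i: "i < n"
  shows "0 \<le> d i"
proof -
  have "U\<^sup>\<dagger> * A * U = mat_diag n (\<lambda>i. complex_of_real (d i))"
    by (rule unitary_conj_cancel[OF U(1)]) (auto simp: U(2) wdiag_def)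
  with psd_diag_index_nonneg[OF A unitary_carrier[OF U(1)] i] i show ?thesis
    by (simp add: mat_diag_def)
qed

text \<open>\<open>matfun\<close> works with a decomposition picked by \<open>SOME\<close>. That
  choice does not depend on the function, so exposing it once gives a single eigenbasis that serves
  every \<open>f\<close> simultaneously.\<close>

theorem psd_decomp:
  assumes A: "psd n A"
  obtains U d where "unitary n U" "A = wdiag n U d" "\<And>i. i < n \<Longrightarrow> 0 \<le> d i"
    "\<And>f. matfun f A = wdiag n U (\<lambda>i. f (d i))"
proof -
  note Ac = psd_carrier[OF A]
  obtain U d where Ud: "(SOME (U, d). spec_decomp A U d) = (U, d)" by fastforce
  have "\<exists>p. case p of (U, d) \<Rightarrow> spec_decomp A U d"
    using psd_spectral[OF A] spec_decomp_wdiag[OF Ac] by auto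
  from someI_ex[OF this] have sd: "spec_decomp A U d" using Ud by simp
  then have UA: "unitary n U" "A = wdiag n U d" using spec_decomp_wdiag[OF Ac] by auto
  moreover have "matfun f A = wdiag n U (\<lambda>i. f (d i))" for f
    unfolding matfun_def Ud wdiag_def using Ac by simp
  ultimately show ?thesis using psd_eigenvalues_nonneg[OF A UA] that by blast
qed

definition trpow :: "complex mat \<Rightarrow> real \<Rightarrow> real" where
  "trpow A z = Re (mtrace (mpow A z))"

text \<open>Equal characteristic polynomials mean equal multisets of eigenvalues, and a sum over all
  eigenvalues does not see their order. Hence \<open>trpow\<close> may be computed from any
  decomposition and depends only on the spectrum.\<close>

lemma char_poly_eq_sum:
  fixes f :: "real \<Rightarrow> real"
  assumes U: "unitary n U" and V: "unitary n V"
    and eq: "char_poly (wdiag n U d) = char_poly (wdiag n V e)"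
  shows "(\<Sum>i<n. f (d i)) = (\<Sum>i<n. f (e i))"
proof -
  let ?l = "\<lambda>d. map (\<lambda>i. complex_of_real (d i)) [0..<n]"
  have "mset (?l d) = mset (?l e)"
    by (rule char_poly_prod_list_eq_mset) (use eq in \<open>simp only: char_poly_wdiag[OF U] char_poly_wdiag[OF V]\<close>)
  then have "image_mset (f \<circ> Re) (mset (?l d)) = image_mset (f \<circ> Re) (mset (?l e))" by simp
  then have "sum_mset (mset (map (\<lambda>i. f (d i)) [0..<n])) = sum_mset (mset (map (\<lambda>i. f (e i)) [0..<n]))"
    by (simp add: o_def flip: mset_map)
  then have "sum_list (map (\<lambda>i. f (d i)) [0..<n]) = sum_list (map (\<lambda>i. f (e i)) [0..<n])"
    by (simp only: sum_mset_sum_list)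
  then show ?thesis by (simp add: sum_list_distinct_conv_sum_set atLeast0LessThan)
qed

lemma trpow_wdiag:
  assumes A: "psd n A" and U: "unitary n U" "A = wdiag n U d"
  shows "trpow A z = (\<Sum>i<n. d i powr z)"
proof -
  obtain V e where V: "unitary n V" "A = wdiag n V e" "\<And>f. matfun f A = wdiag n V (\<lambda>i. f (e i))"
    using psd_decomp[OF A] by metis
  have "trpow A z = (\<Sum>i<n. e i powr z)"
    unfolding trpow_def mpow_def V(3) by (simp add: mtrace_wdiag[OF V(1)])
  also have "\<dots> = (\<Sum>i<n. d i powr z)"
    by (rule char_poly_eq_sum[OF V(1) U(1)]) (use V(2) U(2) in simp)
  finally show ?thesis .
qed

lemma trpow_char_poly:
  assumes A: "psd n A" and B: "psd n B" and eq: "char_poly A = char_poly B"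
  shows "trpow A z = trpow B z"
proof -
  obtain U d where U: "unitary n U" "A = wdiag n U d" using psd_spectral[OF A] by blast
  obtain V e where V: "unitary n V" "B = wdiag n V e" using psd_spectral[OF B] by blast
  show ?thesis
    unfolding trpow_wdiag[OF A U] trpow_wdiag[OF B V]
    by (rule char_poly_eq_sum[OF U(1) V(1)]) (use U V eq in simp)
qed

section \<open>Peierls and determinant inequalities\<close>

text \<open>Zero eigenvalues occur, so the endpoint 0 has to be included. If one point is 0, the
  claim reduces to \<open>u powr z \<le> u\<close> for the weight \<open>u\<close> of the other
  point.\<close>

lemma convex_on_powr_nonneg:
  assumes z: "(1::real) \<le> z"
  shows "convex_on {0..} (\<lambda>x. x powr z)"
proof (rule convex_onI)
  fix t x y :: real
  assume t: "0 < t" "t < 1" and x: "x \<in> {0..}" and y: "y \<in> {0..}"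
  have le: "u powr z \<le> u" if "0 < u" "u < 1" for u :: real
    using powr_mono'[of 1 z u] that z by simp
  consider "x = 0" | "y = 0" | "x > 0" "y > 0" using x y by fastforce
  then show "((1 - t) *\<^sub>R x + t *\<^sub>R y) powr z \<le> (1 - t) * x powr z + t * y powr z"
  proof cases
    case 1
    then show ?thesis using le[OF t] y t z by (simp add: powr_mult mult_right_mono)
  next
    case 2
    then show ?thesis using le[of "1 - t"] x t z by (simp add: powr_mult mult_right_mono)
  next
    case 3
    then show ?thesis using convex_onD[OF powr_convex[OF z], of t x y] t by simp
  qed
qed simp

lemma wdiag_diag_index:
  assumes W: "W \<in> carrier_mat n n" and j: "j < n"
  shows "wdiag n W d $$ (j,j) = complex_of_real (\<Sum>k<n. d k * (cmod (W $$ (j,k)))\<^sup>2)"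
  unfolding wdiag_index[OF W j j] by (simp add: complex_norm_square[symmetric] del: of_real_power)

lemma wdiag_conj:
  assumes V: "V \<in> carrier_mat n n" and U: "U \<in> carrier_mat n n"
  shows "V\<^sup>\<dagger> * wdiag n U d * V = wdiag n (V\<^sup>\<dagger> * U) d"
  using assms
  by (simp add: wdiag_def adjoint_mult[of _ n n _ n] assoc_mult_mat[of _ n n _ n _ n]
      mult_carrier_mat[of _ n n _ n])

text \<open>In the basis \<open>V\<close> each diagonal entry is an average of the eigenvalues with
  weights \<open>?w j k\<close>. Jensen's inequality applies row by row because rows sum to 1, and
  the column sums then collapse the double sum to the trace.\<close>

lemma peierls:
  assumes A: "psd n A" and V: "unitary n V" and z: "1 \<le> z"
  shows "(\<Sum>j<n. Re ((V\<^sup>\<dagger> * A * V) $$ (j,j)) powr z) \<le> trpow A z"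
proof -
  obtain U d where U: "unitary n U" and AU: "A = wdiag n U d" using psd_spectral[OF A] by blast
  have d: "0 \<le> d i" if "i < n" for i by (rule psd_eigenvalues_nonneg[OF A U AU that])
  define W where "W = V\<^sup>\<dagger> * U"
  have W: "unitary n W" unfolding W_def by (intro unitary_mult unitary_adjoint U V)
  let ?w = "\<lambda>j k. (cmod (W $$ (j,k)))\<^sup>2"
  have "(\<Sum>j<n. Re ((V\<^sup>\<dagger> * A * V) $$ (j,j)) powr z) = (\<Sum>j<n. (\<Sum>k<n. d k * ?w j k) powr z)"
    unfolding AU wdiag_conj[OF unitary_carrier[OF V] unitary_carrier[OF U]] W_def[symmetric]
    by (intro sum.cong) (auto simp: wdiag_diag_index[OF unitary_carrier[OF W]] simp flip: of_real_mult of_real_power of_real_sum)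
  also have "\<dots> \<le> (\<Sum>j<n. \<Sum>k<n. ?w j k * d k powr z)"
  proof (rule sum_mono)
    fix j assume "j \<in> {..<n}"
    then have j: "j < n" by simp
    then show "(\<Sum>k<n. d k * ?w j k) powr z \<le> (\<Sum>k<n. ?w j k * d k powr z)"
      using convex_on_sum[OF _ _ convex_on_powr_nonneg[OF z] unitary_row_sum[OF W j], of d] d
      by (auto simp: mult.commute)
  qed
  also have "\<dots> = (\<Sum>k<n. \<Sum>j<n. ?w j k * d k powr z)" by (rule sum.swap)
  also have "\<dots> = (\<Sum>k<n. d k powr z)"
    by (intro sum.cong) (auto simp: unitary_col_sum[OF W] simp flip: sum_distrib_right)
  finally show ?thesis by (simp add: trpow_wdiag[OF A U AU])
qed

section \<open>Determinants by triangularization\<close>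

lemma det_unitary_conj:
  assumes V: "unitary n V" and T: "T \<in> carrier_mat n n"
  shows "det (V * T * V\<^sup>\<dagger>) = det T"
proof -
  note [simp] = unitary_carrier[OF V] T
  have "det V * det (V\<^sup>\<dagger>) = 1"
    using det_mult[of V n "V\<^sup>\<dagger>"] by (simp add: unitary_right[OF V])
  then show ?thesis
    by (simp add: det_mult[of _ n] mult_carrier_mat[of _ n n _ n])
qed

lemma det_triangular_prod:
  assumes "T \<in> carrier_mat n n" "upper_triangular T"
  shows "det T = (\<Prod>j<n. T $$ (j,j))"
  using det_upper_triangular[OF assms(2,1)] assms(1)
  by (simp add: prod_list_diag_prod atLeast0LessThan)

lemma mult_adjoint_index:
  fixes A B :: "complex mat"
  assumes "A \<in> carrier_mat n n" "B \<in> carrier_mat n n" "i < n" "j < n"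
  shows "(A * B\<^sup>\<dagger>) $$ (i,j) = (\<Sum>k<n. A $$ (i,k) * cnj (B $$ (j,k)))"
  using assms by (subst mat_mult_index[of _ n n _ n]) auto

lemma conj_mult_adjoint:
  fixes P Q :: "complex mat"
  assumes "V \<in> carrier_mat n n" "P \<in> carrier_mat n n" "Q \<in> carrier_mat n n"
  shows "V\<^sup>\<dagger> * (P * Q\<^sup>\<dagger>) * V = (V\<^sup>\<dagger> * P) * (V\<^sup>\<dagger> * Q)\<^sup>\<dagger>"
  using assms by (simp add: adjoint_mult[of _ n n _ n] assoc_mult_mat[of _ n n _ n _ n]
      mult_carrier_mat[of _ n n _ n])

lemma conj_add:
  assumes "V \<in> carrier_mat n n" "A \<in> carrier_mat n n" "B \<in> carrier_mat n n"
  shows "V\<^sup>\<dagger> * (A + B) * V = V\<^sup>\<dagger> * A * V + V\<^sup>\<dagger> * (B :: complex mat) * V"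
  using assms by (simp add: mult_add_distrib_mat[of _ n n _ n] add_mult_distrib_mat[of _ n n _ _ n]
      mult_carrier_mat[of _ n n _ n])

lemma schur_conj:
  fixes A :: "complex mat"
  assumes "A \<in> carrier_mat n n" "char_poly A = (\<Prod>e\<leftarrow>es. [:- e, 1:])"
  obtains V T where "unitary n V" "T \<in> carrier_mat n n" "upper_triangular T" "diag_mat T = es"
    "A = V * T * V\<^sup>\<dagger>" "V\<^sup>\<dagger> * A * V = T"
  using unitary_schur[OF assms] unitary_conj_cancel by metis

text \<open>Cauchy-Schwarz in its arithmetic-mean form, chosen because two such bounds can be added
  when only the sums of squared norms are known.\<close>

lemma cmod_sum_mult_cnj_le:
  "cmod (\<Sum>k\<in>K. f k * cnj (g k)) \<le> ((\<Sum>k\<in>K. (cmod (f k))\<^sup>2) + (\<Sum>k\<in>K. (cmod (g k))\<^sup>2)) / 2"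
proof -
  have "cmod (\<Sum>k\<in>K. f k * cnj (g k)) \<le> (\<Sum>k\<in>K. cmod (f k * cnj (g k)))"
    by (rule norm_sum)
  also have "\<dots> \<le> (\<Sum>k\<in>K. ((cmod (f k))\<^sup>2 + (cmod (g k))\<^sup>2) / 2)"
  proof (rule sum_mono)
    fix k
    show "cmod (f k * cnj (g k)) \<le> ((cmod (f k))\<^sup>2 + (cmod (g k))\<^sup>2) / 2"
      using sum_squares_bound[of "cmod (f k)" "cmod (g k)"] by (simp add: norm_mult)
  qed
  finally show ?thesis by (simp add: sum.distrib flip: sum_divide_distrib)
qed

text \<open>The hypotheses say that the block rows (P R) and (Q S) have orthonormal rows, so their
  product \<open>?K\<close> is a contraction. Concretely, after unitary triangularization each
  diagonal entry of \<open>T\<close> is an inner product of two unit vectors, and the determinant is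
  the product of these entries.\<close>

lemma det_contraction:
  fixes P Q R S :: "complex mat"
  assumes [simp]: "P \<in> carrier_mat n n" "Q \<in> carrier_mat n n" "R \<in> carrier_mat n n" "S \<in> carrier_mat n n"
    and one: "P * P\<^sup>\<dagger> + R * R\<^sup>\<dagger> = 1\<^sub>m n" "Q * Q\<^sup>\<dagger> + S * S\<^sup>\<dagger> = 1\<^sub>m n"
  shows "cmod (det (P * Q\<^sup>\<dagger> + R * S\<^sup>\<dagger>)) \<le> 1"
proof -
  let ?K = "P * Q\<^sup>\<dagger> + R * S\<^sup>\<dagger>"
  have K: "?K \<in> carrier_mat n n" by (simp add: mult_carrier_mat[of _ n n _ n])
  obtain es where "char_poly ?K = (\<Prod>e\<leftarrow>es. [:- e, 1:])"
    using char_poly_factorized[OF K] by blast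
  from schur_conj[OF K this] obtain V T where V: "unitary n V" and T: "T \<in> carrier_mat n n"
    "upper_triangular T" "?K = V * T * V\<^sup>\<dagger>" "V\<^sup>\<dagger> * ?K * V = T" by metis
  note [simp] = unitary_carrier[OF V]
  define p q r s where "p = V\<^sup>\<dagger> * P" and "q = V\<^sup>\<dagger> * Q" and "r = V\<^sup>\<dagger> * R" and "s = V\<^sup>\<dagger> * S"
  have c [simp]: "p \<in> carrier_mat n n" "q \<in> carrier_mat n n" "r \<in> carrier_mat n n" "s \<in> carrier_mat n n"
    by (simp_all add: p_def q_def r_def s_def mult_carrier_mat[of _ n n _ n])
  have TT: "T = p * q\<^sup>\<dagger> + r * s\<^sup>\<dagger>"
    unfolding T(4)[symmetric] p_def q_def r_def s_def
    by (simp add: conj_add[of _ n] conj_mult_adjoint[of _ n] mult_carrier_mat[of _ n n _ n])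
  have VV: "V\<^sup>\<dagger> * 1\<^sub>m n * V = 1\<^sub>m n"
    using right_mult_one_mat[OF adjoint_carrier[OF unitary_carrier[OF V]]] by (simp add: unitary_left[OF V])
  have "p * p\<^sup>\<dagger> + r * r\<^sup>\<dagger> = V\<^sup>\<dagger> * (P * P\<^sup>\<dagger> + R * R\<^sup>\<dagger>) * V"
    unfolding p_def r_def
    by (simp add: conj_add[of _ n] conj_mult_adjoint[of _ n] mult_carrier_mat[of _ n n _ n])
  then have pr: "p * p\<^sup>\<dagger> + r * r\<^sup>\<dagger> = 1\<^sub>m n" unfolding one VV .
  have "q * q\<^sup>\<dagger> + s * s\<^sup>\<dagger> = V\<^sup>\<dagger> * (Q * Q\<^sup>\<dagger> + S * S\<^sup>\<dagger>) * V"
    unfolding q_def s_def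
    by (simp add: conj_add[of _ n] conj_mult_adjoint[of _ n] mult_carrier_mat[of _ n n _ n])
  then have qs: "q * q\<^sup>\<dagger> + s * s\<^sup>\<dagger> = 1\<^sub>m n" unfolding one VV .
  have row: "(\<Sum>k<n. (cmod (f $$ (j,k)))\<^sup>2) + (\<Sum>k<n. (cmod (g $$ (j,k)))\<^sup>2) = 1"
    if fg: "f \<in> carrier_mat n n" "g \<in> carrier_mat n n" "f * f\<^sup>\<dagger> + g * g\<^sup>\<dagger> = 1\<^sub>m n" and j: "j < n"
    for f g :: "complex mat" and j
  proof -
    let ?r = "(\<Sum>k<n. (cmod (f $$ (j,k)))\<^sup>2) + (\<Sum>k<n. (cmod (g $$ (j,k)))\<^sup>2)"
    have "(f * f\<^sup>\<dagger> + g * g\<^sup>\<dagger>) $$ (j,j) = (f * f\<^sup>\<dagger>) $$ (j,j) + (g * g\<^sup>\<dagger>) $$ (j,j)"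
      using fg(1,2) j by (intro index_add_mat) auto
    also have "\<dots> = complex_of_real ?r"
      unfolding mult_adjoint_index[OF fg(1,1) j j] mult_adjoint_index[OF fg(2,2) j j]
      by (simp only: complex_norm_square[symmetric] of_real_sum of_real_add)
    finally have "complex_of_real ?r = 1" unfolding fg(3) using j by (metis index_one_mat(1))
    then show ?thesis by (simp only: of_real_eq_1_iff)
  qed
  have "cmod (T $$ (j,j)) \<le> 1" if j: "j < n" for j
  proof -
    have "T $$ (j,j) = (p * q\<^sup>\<dagger>) $$ (j,j) + (r * s\<^sup>\<dagger>) $$ (j,j)"
      unfolding TT using j carrier_matD[OF c(3)] carrier_matD[OF c(4)] by (intro index_add_mat) auto
    also have "\<dots> = (\<Sum>k<n. p $$ (j,k) * cnj (q $$ (j,k))) + (\<Sum>k<n. r $$ (j,k) * cnj (s $$ (j,k)))"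
      unfolding mult_adjoint_index[OF c(1,2) j j] mult_adjoint_index[OF c(3,4) j j] ..
    finally have "cmod (T $$ (j,j)) \<le> cmod (\<Sum>k<n. p $$ (j,k) * cnj (q $$ (j,k)))
        + cmod (\<Sum>k<n. r $$ (j,k) * cnj (s $$ (j,k)))"
      by (simp add: norm_triangle_ineq)
    also have "\<dots> \<le> 1"
    proof -
      \<comment> \<open>Each of the two row vectors is split into two parts whose squared norms add
        up to 1; the four halves together give at most 1.\<close>
      have "a + b \<le> 1" if "a \<le> (A + B) / 2" "b \<le> (C + D) / 2" "A + C = 1" "B + D = 1"
        for a b A B C D :: real
        using that by argo
      from this[OF cmod_sum_mult_cnj_le cmod_sum_mult_cnj_le row[OF c(1) c(3) pr j] row[OF c(2) c(4) qs j]]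
      show ?thesis .
    qed
    finally show ?thesis .
  qed
  then have "(\<Prod>j<n. cmod (T $$ (j,j))) \<le> 1" by (intro prod_le_1) auto
  then show ?thesis
    unfolding T(3) det_unitary_conj[OF V T(1)] det_triangular_prod[OF T(1,2)]
    by (simp add: prod_norm)
qed

lemma wdiag_det:
  assumes U: "unitary n U"
  shows "det (wdiag n U d) = complex_of_real (\<Prod>i<n. d i)"
  unfolding wdiag_def
  by (subst det_unitary_conj[OF U], simp, subst det_triangular_prod[of _ n])
     (auto simp: mat_diag_def)

lemma wdiag_add:
  assumes U: "U \<in> carrier_mat n n"
  shows "wdiag n U d + wdiag n U e = wdiag n U (\<lambda>i. d i + e i)"
  using U by (intro eq_matI)
    (auto simp: wdiag_index[OF U] carrier_matD[OF wdiag_carrier[OF U]] distrib_right sum.distrib)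

lemma wdiag_smult:
  assumes U: "U \<in> carrier_mat n n"
  shows "complex_of_real c \<cdot>\<^sub>m wdiag n U d = wdiag n U (\<lambda>i. c * d i)"
  using U by (intro eq_matI)
    (auto simp: wdiag_index[OF U] carrier_matD[OF wdiag_carrier[OF U]] sum_distrib_left mult.assoc)

text \<open>Here \<open>wdiag n U g\<close> plays the inverse square root of
  \<open>1 + Y Y\<^sup>\<dagger>\<close>. The conclusion has the shape of a hypothesis of
  \<open>det_contraction\<close>.\<close>

lemma wdiag_congruence_one:
  assumes Y: "Y \<in> carrier_mat n n" and U: "unitary n U" and YU: "Y * Y\<^sup>\<dagger> = wdiag n U b"
    and g: "\<And>i. i < n \<Longrightarrow> g i * (1 + b i) * g i = 1"
  shows "wdiag n U g * (wdiag n U g)\<^sup>\<dagger> + (wdiag n U g * Y) * (wdiag n U g * Y)\<^sup>\<dagger> = 1\<^sub>m n"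
proof -
  let ?G = "wdiag n U g"
  note Uc = unitary_carrier[OF U]
  have "(?G * Y) * (?G * Y)\<^sup>\<dagger> = ?G * (Y * Y\<^sup>\<dagger>) * ?G"
    using Y Uc by (simp add: adjoint_mult[of _ n n _ n] assoc_mult_mat[of _ n n _ n _ n]
      mult_carrier_mat[of _ n n _ n] wdiag_adjoint)
  also have "\<dots> = wdiag n U (\<lambda>i. g i * b i * g i)" by (simp add: YU wdiag_mult[OF U])
  finally have "?G * ?G\<^sup>\<dagger> + (?G * Y) * (?G * Y)\<^sup>\<dagger> = wdiag n U (\<lambda>i. g i * g i + g i * b i * g i)"
    by (simp add: wdiag_adjoint[OF Uc] wdiag_mult[OF U] wdiag_add[OF Uc])
  also have "\<dots> = 1\<^sub>m n" using g by (intro wdiag_one[OF U]) (simp add: algebra_simps)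
  finally show ?thesis .
qed

text \<open>Multiplying by \<open>(1 + Y Y\<^sup>\<dagger>)\<^sup>-\<^sup>1\<^sup>/\<^sup>2\<close> on the left and \<open>(1 + Z Z\<^sup>\<dagger>)\<^sup>-\<^sup>1\<^sup>/\<^sup>2\<close> on
  the right turns \<open>1 + Y Z\<^sup>\<dagger>\<close> into a contraction.\<close>

theorem det_cauchy_schwarz:
  fixes Y Z :: "complex mat"
  assumes Y: "Y \<in> carrier_mat n n" and Z: "Z \<in> carrier_mat n n"
    and U: "unitary n U" "Y * Y\<^sup>\<dagger> = wdiag n U b"
    and V: "unitary n V" "Z * Z\<^sup>\<dagger> = wdiag n V c"
  shows "(cmod (det (1\<^sub>m n + Y * Z\<^sup>\<dagger>)))\<^sup>2 \<le> (\<Prod>i<n. 1 + b i) * (\<Prod>i<n. 1 + c i)"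
proof -
  note Uc [simp] = unitary_carrier[OF U(1)] and Vc [simp] = unitary_carrier[OF V(1)] and Y [simp] and Z [simp]
  have b: "0 \<le> b i" if "i < n" for i
    using psd_eigenvalues_nonneg[OF _ U that] psd_mult_adjoint[OF Y] by simp
  have c: "0 \<le> c i" if "i < n" for i
    using psd_eigenvalues_nonneg[OF _ V that] psd_mult_adjoint[OF Z] by simp
  define g h where "g i = 1 / sqrt (1 + b i)" and "h i = 1 / sqrt (1 + c i)" for i
  have g: "g i * (1 + b i) * g i = 1" "0 < g i" if "i < n" for i
    using b[OF that] by (simp_all add: g_def divide_simps)
  have h: "h i * (1 + c i) * h i = 1" "0 < h i" if "i < n" for i
    using c[OF that] by (simp_all add: h_def divide_simps)
  define G H where "G = wdiag n U g" and "H = wdiag n V h"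
  have [simp]: "G \<in> carrier_mat n n" "H \<in> carrier_mat n n" by (simp_all add: G_def H_def)
  have gpos: "(\<Prod>i<n. g i) > 0" "(\<Prod>i<n. h i) > 0" using g(2) h(2) by (auto intro!: prod_pos)
  have "cmod (det (G * H\<^sup>\<dagger> + (G * Y) * (H * Z)\<^sup>\<dagger>)) \<le> 1"
  proof (rule det_contraction[of _ n])
    show "G * G\<^sup>\<dagger> + G * Y * (G * Y)\<^sup>\<dagger> = 1\<^sub>m n"
      unfolding G_def by (rule wdiag_congruence_one[OF Y U g(1)])
    show "H * H\<^sup>\<dagger> + H * Z * (H * Z)\<^sup>\<dagger> = 1\<^sub>m n"
      unfolding H_def by (rule wdiag_congruence_one[OF Z V h(1)])
  qed (simp_all add: mult_carrier_mat[of _ n n _ n])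
  also have "G * H\<^sup>\<dagger> + (G * Y) * (H * Z)\<^sup>\<dagger> = G * (1\<^sub>m n + Y * Z\<^sup>\<dagger>) * H"
  proof -
    have "H\<^sup>\<dagger> = H" by (simp add: H_def wdiag_adjoint)
    then have "(G * Y) * (H * Z)\<^sup>\<dagger> = G * (Y * Z\<^sup>\<dagger>) * H"
      by (simp add: adjoint_mult[of _ n n _ n] assoc_mult_mat[of _ n n _ n _ n] mult_carrier_mat[of _ n n _ n])
    moreover have "G * (1\<^sub>m n + Y * Z\<^sup>\<dagger>) * H = G * H + G * (Y * Z\<^sup>\<dagger>) * H"
      by (simp add: mult_add_distrib_mat[of _ n n _ n] add_mult_distrib_mat[of _ n n _ _ n]
          mult_carrier_mat[of _ n n _ n] right_mult_one_mat[of _ n n])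
    ultimately show ?thesis using \<open>H\<^sup>\<dagger> = H\<close> by simp
  qed
  also have "det (G * (1\<^sub>m n + Y * Z\<^sup>\<dagger>) * H) = det G * det (1\<^sub>m n + Y * Z\<^sup>\<dagger>) * det H"
    by (simp add: det_mult[of _ n] mult_carrier_mat[of _ n n _ n])
  also have "cmod \<dots> = (\<Prod>i<n. g i) * cmod (det (1\<^sub>m n + Y * Z\<^sup>\<dagger>)) * (\<Prod>i<n. h i)"
    using gpos
    by (simp add: G_def H_def wdiag_det[OF U(1)] wdiag_det[OF V(1)] norm_mult del: of_real_prod)
  finally have le: "(\<Prod>i<n. g i) * cmod (det (1\<^sub>m n + Y * Z\<^sup>\<dagger>)) * (\<Prod>i<n. h i) \<le> 1" (is "?g * ?d * ?h \<le> 1") .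
  \<comment> \<open>\<open>B\<close> and \<open>C\<close> record that the squared determinants of
    \<open>G\<close> and \<open>H\<close> are the reciprocals of the two right-hand products, so
    squaring \<open>le\<close> and cancelling finishes the proof.\<close>
  have "?g * ?g * (\<Prod>i<n. 1 + b i) = (\<Prod>i<n. g i * (1 + b i) * g i)"
    by (simp add: prod.distrib mult_ac)
  then have B: "?g * ?g * (\<Prod>i<n. 1 + b i) = 1" using g(1) by simp
  have "?h * ?h * (\<Prod>i<n. 1 + c i) = (\<Prod>i<n. h i * (1 + c i) * h i)"
    by (simp add: prod.distrib mult_ac)
  then have C: "?h * ?h * (\<Prod>i<n. 1 + c i) = 1" using h(1) by simp
  have "(?g * ?d * ?h)\<^sup>2 \<le> 1" using le gpos by (intro power_le_one) auto
  then have "(?g * ?g) * (?h * ?h) * ?d\<^sup>2 \<le> (?g * ?g * (\<Prod>i<n. 1 + b i)) * (?h * ?h * (\<Prod>i<n. 1 + c i))"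
    unfolding B C by (simp add: power2_eq_square mult_ac)
  then have "(?g * ?g * (?h * ?h)) * ?d\<^sup>2 \<le> (?g * ?g * (?h * ?h)) * ((\<Prod>i<n. 1 + b i) * (\<Prod>i<n. 1 + c i))"
    by (simp add: mult_ac)
  then show ?thesis using gpos by (simp add: mult_le_cancel_left)
qed

text \<open>Only the spectrum of \<open>A\<close> is known, and \<open>A\<close> need not be normal,
  so it is triangularized rather than diagonalized; the identity and the factor \<open>t\<close>
  pass through the conjugation.\<close>

lemma det_one_plus_smult:
  fixes A :: "complex mat"
  assumes A: "A \<in> carrier_mat n n" and X: "unitary n W" "char_poly A = char_poly (wdiag n W x)"
  shows "det (1\<^sub>m n + complex_of_real t \<cdot>\<^sub>m A) = complex_of_real (\<Prod>i<n. 1 + t * x i)"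
proof -
  have "char_poly A = (\<Prod>a\<leftarrow>map (\<lambda>i. complex_of_real (x i)) [0..<n]. [:- a, 1:])"
    unfolding X(2) by (rule char_poly_wdiag[OF X(1)])
  from schur_conj[OF A this] obtain V T where V: "unitary n V" and T: "T \<in> carrier_mat n n"
    "upper_triangular T" "diag_mat T = map (\<lambda>i. complex_of_real (x i)) [0..<n]" "A = V * T * V\<^sup>\<dagger>" by metis
  note [simp] = unitary_carrier[OF V] T(1)
  have Tj: "T $$ (j,j) = complex_of_real (x j)" if "j < n" for j
    using arg_cong[OF T(3), of "\<lambda>l. l ! j"] that carrier_matD[OF T(1)] by (simp add: diag_mat_def)
  let ?S = "1\<^sub>m n + complex_of_real t \<cdot>\<^sub>m T"
  have "V * ?S * V\<^sup>\<dagger> = 1\<^sub>m n + complex_of_real t \<cdot>\<^sub>m A"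
    unfolding T(4)
    by (simp add: mult_add_distrib_mat[of _ n n _ n] add_mult_distrib_mat[of _ n n _ _ n]
          mult_carrier_mat[of _ n n _ n] right_mult_one_mat[of _ n n] unitary_right[OF V]
          mult_smult_distrib[of _ n n _ n] mult_smult_assoc_mat[of _ n n _ n])
  then have "det (1\<^sub>m n + complex_of_real t \<cdot>\<^sub>m A) = det ?S"
    using det_unitary_conj[OF V, of ?S] by simp
  also have "\<dots> = (\<Prod>j<n. ?S $$ (j,j))"
    using upper_triangularD[OF T(2)] carrier_matD[OF T(1)] by (intro det_triangular_prod) auto
  also have "\<dots> = (\<Prod>j<n. complex_of_real (1 + t * x j))"
    using carrier_matD[OF T(1)] by (intro prod.cong) (auto simp: Tj)
  finally show ?thesis by simp
qed

section \<open>Fractional powers from logarithms\<close>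

text \<open>For \<open>0 < z < 1\<close>, substituting \<open>t \<mapsto> t / x\<close> shows that \<open>\<integral> t\<^sup>-\<^sup>z\<^sup>-\<^sup>1 ln (1 + t x) dt\<close> over \<open>t > 0\<close> is
  a constant multiple of \<open>x\<^sup>z\<close>. Only positivity and finiteness of the constant matter.\<close>

definition log_kernel :: "real \<Rightarrow> real \<Rightarrow> real \<Rightarrow> ennreal" where
  "log_kernel z x t = ennreal (t powr (- z - 1) * ln (1 + t * x)) * indicator {0<..} t"

lemma log_kernel_measurable [measurable]: "log_kernel z x \<in> borel_measurable borel"
  unfolding log_kernel_def by measurable

definition log_const :: "real \<Rightarrow> ennreal" where
  "log_const z = (\<integral>\<^sup>+t. log_kernel z 1 t \<partial>lborel)"

lemma log_kernel_integral:
  assumes x: "0 \<le> x" and z: "0 < z"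
  shows "(\<integral>\<^sup>+t. log_kernel z x t \<partial>lborel) = ennreal (x powr z) * log_const z"
proof (cases "x = 0")
  case True
  then show ?thesis using z by (simp add: log_kernel_def)
next
  case False
  with x have x: "x > 0" by simp
  have "log_const z = ennreal \<bar>x\<bar> * (\<integral>\<^sup>+t. log_kernel z 1 (0 + x * t) \<partial>lborel)"
    unfolding log_const_def by (rule nn_integral_real_affine) (use x in auto)
  also have "(\<integral>\<^sup>+t. log_kernel z 1 (0 + x * t) \<partial>lborel)
      = (\<integral>\<^sup>+t. ennreal (x powr (- z - 1)) * log_kernel z x t \<partial>lborel)"
  proof (rule nn_integral_cong)
    fix t
    show "log_kernel z 1 (0 + x * t) = ennreal (x powr (- z - 1)) * log_kernel z x t"
    proof (cases "t > 0")
      case True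
      then show ?thesis using x
        by (simp add: log_kernel_def powr_mult mult_ac flip: ennreal_mult)
    next
      case False
      then show ?thesis using x by (simp add: log_kernel_def zero_less_mult_iff)
    qed
  qed
  also have "\<dots> = ennreal (x powr (- z - 1)) * (\<integral>\<^sup>+t. log_kernel z x t \<partial>lborel)"
    by (rule nn_integral_cmult) simp
  finally have "ennreal (x powr z) * log_const z
     = ennreal (x powr z * (x * x powr (- z - 1))) * (\<integral>\<^sup>+t. log_kernel z x t \<partial>lborel)"
    using x by (simp add: ennreal_mult mult.assoc)
  also have "x powr z * (x * x powr (- z - 1)) = 1"
    using x by (simp add: powr_diff powr_minus)
  finally show ?thesis by simp
qed

text \<open>On the interval from 1 to 2 the kernel lies above the constant \<open>k\<close>; the
  minimum in \<open>k\<close> covers both signs of the exponent.\<close>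

lemma log_const_pos:
  shows "log_const z > 0"
proof -
  define k where "k = min 1 (2 powr (- z - 1)) * ln 2"
  have k: "k > 0" by (simp add: k_def)
  have "0 < ennreal k" using k by simp
  also have "\<dots> = (\<integral>\<^sup>+t. ennreal k * indicator {1..2::real} t \<partial>lborel)"
    by (simp add: nn_integral_cmult_indicator)
  also have "\<dots> \<le> log_const z"
    unfolding log_const_def
  proof (rule nn_integral_mono)
    fix t :: real
    show "ennreal k * indicator {1..2} t \<le> log_kernel z 1 t"
    proof (cases "t \<in> {1..2}")
      case True
      have "min 1 (2 powr (- z - 1)) \<le> t powr (- z - 1)"
      proof (cases "- z - 1 \<ge> 0")
        case True
        then have "1 \<le> t powr (- z - 1)" using \<open>t \<in> {1..2}\<close> by (intro ge_one_powr_ge_zero) auto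
        then show ?thesis by simp
      next
        case False
        then have "2 powr (- z - 1) \<le> t powr (- z - 1)"
          using True by (intro powr_mono2') auto
        then show ?thesis by simp
      qed
      moreover have "ln 2 \<le> ln (1 + t)" using True by simp
      ultimately have "k \<le> t powr (- z - 1) * ln (1 + t)"
        unfolding k_def by (intro mult_mono) auto
      then show ?thesis using True by (simp add: log_kernel_def ennreal_leI)
    qed simp
  qed
  finally show ?thesis .
qed

text \<open>Near 0, \<open>ln (1 + t) \<le> t\<close> leaves \<open>t powr (- z)\<close>, integrable
  because \<open>z < 1\<close>. Beyond 1, the logarithm is at most \<open>C * t powr (z/2)\<close>,
  with the constant coming from \<open>1 + t \<le> 2 * t\<close>, and the remaining exponent
  \<open>- z/2 - 1\<close> is integrable because \<open>z > 0\<close>.\<close>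

lemma log_const_finite:
  assumes z: "0 < z" "z < 1"
  shows "log_const z < \<infinity>"
proof -
  define C where "C = 2 powr (z/2) / (z/2)"
  let ?f = "\<lambda>t. indicator {0..1} t * t powr (- z)" and ?g = "\<lambda>t. indicator {1..} t * (C * t powr (- z/2 - 1))"
  have C: "C > 0" using z by (simp add: C_def)
  have "((\<lambda>t. t powr (- z)) has_integral (1 powr (- z + 1) / (- z + 1))) {0..1}"
    by (rule has_integral_powr_from_0) (use z in auto)
  from nn_integral_has_integral_lebesgue[OF _ this]
  have f: "(\<integral>\<^sup>+t. ennreal (?f t) \<partial>lborel) < \<infinity>" by simp
  have "((\<lambda>t. C * t powr (- z/2 - 1)) has_integral C * (-(1 powr ((- z/2 - 1)+1)) / ((- z/2 - 1)+1))) {1..}"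
    by (intro has_integral_mult_right has_integral_powr_to_inf) (use z in auto)
  from nn_integral_has_integral_lebesgue[OF _ this]
  have g: "(\<integral>\<^sup>+t. ennreal (?g t) \<partial>lborel) < \<infinity>" using C by simp
  have "log_const z \<le> (\<integral>\<^sup>+t. ennreal (?f t) + ennreal (?g t) \<partial>lborel)"
    unfolding log_const_def
  proof (rule nn_integral_mono)
    fix t :: real
    consider "t \<le> 0" | "0 < t" "t \<le> 1" | "1 < t" by linarith
    then show "log_kernel z 1 t \<le> ennreal (?f t) + ennreal (?g t)"
    proof cases
      case 1
      then show ?thesis by (simp add: log_kernel_def)
    next
      case 2
      have "t powr (- z - 1) * ln (1 + t) \<le> t powr (- z - 1) * t"
        using 2 by (intro mult_left_mono ln_add_one_self_le_self) auto
      also have "\<dots> = t powr (- z)" using 2 by (simp add: powr_diff)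
      finally have "log_kernel z 1 t \<le> ennreal (?f t)"
        using 2 by (simp add: log_kernel_def ennreal_leI)
      also have "\<dots> \<le> ennreal (?f t) + ennreal (?g t)" by simp
      finally show ?thesis .
    next
      case 3
      have "ln (1 + t) \<le> (1 + t) powr (z/2) / (z/2)"
        using 3 z by (intro ln_powr_bound) auto
      also have "\<dots> \<le> (2 * t) powr (z/2) / (z/2)"
        using 3 z by (intro divide_right_mono powr_mono2) auto
      also have "\<dots> = C * t powr (z/2)" using 3 by (simp add: C_def powr_mult)
      finally have "t powr (- z - 1) * ln (1 + t) \<le> t powr (- z - 1) * (C * t powr (z/2))"
        by (intro mult_left_mono) auto
      also have "\<dots> = C * t powr (- z/2 - 1)" using 3 by (simp flip: powr_add)
      finally have "log_kernel z 1 t \<le> ennreal (?g t)"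
        using 3 by (simp add: log_kernel_def ennreal_leI)
      also have "\<dots> \<le> ennreal (?f t) + ennreal (?g t)" by simp
      finally show ?thesis .
    qed
  qed
  also have "\<dots> = (\<integral>\<^sup>+t. ennreal (?f t) \<partial>lborel) + (\<integral>\<^sup>+t. ennreal (?g t) \<partial>lborel)"
    by (rule nn_integral_add) measurable
  also have "\<dots> < \<infinity>" using f g by simp
  finally show ?thesis .
qed

text \<open>Integrating the hypothesis against \<open>t powr (- z - 1)\<close> turns every logarithm
  into a power times \<open>log_const z\<close>, which is positive and finite and therefore
  cancels.\<close>

lemma sum_powr_le_of_sum_ln_le:
  fixes z :: real and a b c :: "'i \<Rightarrow> real"
  assumes z: "0 < z" "z < 1"
    and nn: "\<And>i. i \<in> I \<Longrightarrow> 0 \<le> a i" "\<And>i. i \<in> I \<Longrightarrow> 0 \<le> b i" "\<And>i. i \<in> I \<Longrightarrow> 0 \<le> c i"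
    and le: "\<And>t. t > 0 \<Longrightarrow> 2 * (\<Sum>i\<in>I. ln (1 + t * a i)) \<le> (\<Sum>i\<in>I. ln (1 + t * b i)) + (\<Sum>i\<in>I. ln (1 + t * c i))"
  shows "2 * (\<Sum>i\<in>I. a i powr z) \<le> (\<Sum>i\<in>I. b i powr z) + (\<Sum>i\<in>I. c i powr z)"
proof -
  have K: "(\<Sum>i\<in>I. log_kernel z (f i) t) = ennreal (t powr (- z - 1) * (\<Sum>i\<in>I. ln (1 + t * f i))) * indicator {0<..} t"
    if "\<And>i. i \<in> I \<Longrightarrow> 0 \<le> f i" for f :: "'i \<Rightarrow> real" and t
  proof (cases "t > 0")
    case True
    with that show ?thesis by (simp add: log_kernel_def sum_ennreal sum_distrib_left)
  qed (simp add: log_kernel_def)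
  have S: "(\<integral>\<^sup>+t. (\<Sum>i\<in>I. log_kernel z (f i) t) \<partial>lborel) = ennreal (\<Sum>i\<in>I. f i powr z) * log_const z"
    if "\<And>i. i \<in> I \<Longrightarrow> 0 \<le> f i" for f :: "'i \<Rightarrow> real"
  proof -
    have "(\<integral>\<^sup>+t. (\<Sum>i\<in>I. log_kernel z (f i) t) \<partial>lborel) = (\<Sum>i\<in>I. \<integral>\<^sup>+t. log_kernel z (f i) t \<partial>lborel)"
      by (rule nn_integral_sum) simp
    also have "\<dots> = (\<Sum>i\<in>I. ennreal (f i powr z) * log_const z)"
      using that z by (intro sum.cong) (auto simp: log_kernel_integral)
    also have "\<dots> = ennreal (\<Sum>i\<in>I. f i powr z) * log_const z"
      by (simp add: sum_ennreal flip: sum_distrib_right)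
    finally show ?thesis .
  qed
  have "ennreal (2 * (\<Sum>i\<in>I. a i powr z)) * log_const z
      = 2 * (\<integral>\<^sup>+t. (\<Sum>i\<in>I. log_kernel z (a i) t) \<partial>lborel)"
    using S[of a] nn(1) by (simp add: ennreal_mult sum_nonneg mult.assoc)
  also have "\<dots> = (\<integral>\<^sup>+t. 2 * (\<Sum>i\<in>I. log_kernel z (a i) t) \<partial>lborel)"
    by (rule nn_integral_cmult[symmetric]) simp
  also have "\<dots> \<le> (\<integral>\<^sup>+t. (\<Sum>i\<in>I. log_kernel z (b i) t) + (\<Sum>i\<in>I. log_kernel z (c i) t) \<partial>lborel)"
  proof (rule nn_integral_mono)
    fix t :: real
    show "2 * (\<Sum>i\<in>I. log_kernel z (a i) t) \<le> (\<Sum>i\<in>I. log_kernel z (b i) t) + (\<Sum>i\<in>I. log_kernel z (c i) t)"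
    proof (cases "t > 0")
      case True
      have nn': "0 \<le> (\<Sum>i\<in>I. ln (1 + t * f i))" if "\<And>i. i \<in> I \<Longrightarrow> 0 \<le> f i" for f :: "'i \<Rightarrow> real"
        using that True by (intro sum_nonneg) simp
      have "t powr (- z - 1) * (2 * (\<Sum>i\<in>I. ln (1 + t * a i)))
         \<le> t powr (- z - 1) * ((\<Sum>i\<in>I. ln (1 + t * b i)) + (\<Sum>i\<in>I. ln (1 + t * c i)))"
        by (intro mult_left_mono le[OF True]) simp
      then have "ennreal (2 * (t powr (- z - 1) * (\<Sum>i\<in>I. ln (1 + t * a i))))
          \<le> ennreal (t powr (- z - 1) * (\<Sum>i\<in>I. ln (1 + t * b i)) + t powr (- z - 1) * (\<Sum>i\<in>I. ln (1 + t * c i)))"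
        by (intro ennreal_leI) (simp add: algebra_simps)
      then show ?thesis
        using True nn' nn by (simp add: K ennreal_mult ennreal_plus)
    qed (simp add: log_kernel_def)
  qed
  also have "\<dots> = (\<integral>\<^sup>+t. (\<Sum>i\<in>I. log_kernel z (b i) t) \<partial>lborel) + (\<integral>\<^sup>+t. (\<Sum>i\<in>I. log_kernel z (c i) t) \<partial>lborel)"
    by (rule nn_integral_add) simp_all
  also have "\<dots> = ennreal ((\<Sum>i\<in>I. b i powr z) + (\<Sum>i\<in>I. c i powr z)) * log_const z"
    using S[of b] S[of c] nn(2,3)
    by (simp add: ennreal_plus sum_nonneg distrib_right)
  finally have "ennreal (2 * (\<Sum>i\<in>I. a i powr z)) \<le> ennreal ((\<Sum>i\<in>I. b i powr z) + (\<Sum>i\<in>I. c i powr z))"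
    using log_const_pos[of z] log_const_finite[OF z]
    by (simp add: ennreal_mult_le_mult_iff mult.commute[of _ "log_const z"])
  then show ?thesis by (subst (asm) ennreal_le_iff) (auto intro!: sum_nonneg add_nonneg_nonneg)
qed

section \<open>Cauchy--Schwarz for traces of powers\<close>

text \<open>The right side is minimal at \<open>r = sqrt (Q / P)\<close>, where it equals twice the
  geometric mean. If \<open>P\<close> or \<open>Q\<close> vanishes, sending \<open>r\<close> to an
  extreme forces \<open>S = 0\<close>.\<close>

lemma sq_le_mult_of_scaled:
  fixes P Q S :: real
  assumes nn: "0 \<le> P" "0 \<le> Q" "0 \<le> S" and le: "\<And>r. r > 0 \<Longrightarrow> 2 * S \<le> r * P + Q / r"
  shows "S\<^sup>2 \<le> P * Q"
proof -
  have deg: "S = 0" if "0 \<le> R" "\<And>r. r > 0 \<Longrightarrow> 2 * S \<le> r * R" for R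
  proof (rule ccontr)
    assume "S \<noteq> 0"
    with nn have S: "S > 0" by simp
    \<comment> \<open>This \<open>r\<close> is small enough to push the bound below
      \<open>S\<close>.\<close>
    have "2 * S \<le> S / (R + 1) * R" using S that(1) by (intro that(2)) auto
    also have "\<dots> \<le> S" using S that(1) by (simp add: divide_simps)
    finally show False using S by simp
  qed
  consider "P = 0" | "Q = 0" | "P > 0" "Q > 0" using nn by fastforce
  then show ?thesis
  proof cases
    case 1
    have "S = 0"
    proof (rule deg[OF nn(2)])
      fix r :: real assume "r > 0"
      then show "2 * S \<le> r * Q" using le[of "1 / r"] 1 by (simp add: mult.commute)
    qed
    then show ?thesis using nn by simp
  next
    case 2
    have "S = 0" by (rule deg[OF nn(1)]) (use le 2 in auto)
    then show ?thesis using nn by simp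
  next
    case 3
    have "sqrt (Q / P) * P = sqrt (P * Q)" "Q / sqrt (Q / P) = sqrt (P * Q)"
      using 3 by (simp_all add: real_sqrt_divide real_sqrt_mult divide_simps flip: mult.assoc)
    with le[of "sqrt (Q / P)"] 3 have "S \<le> sqrt (P * Q)" by simp
    then have "S\<^sup>2 \<le> (sqrt (P * Q))\<^sup>2" using nn by (intro power_mono) auto
    then show ?thesis using nn by simp
  qed
qed

lemma two_ln_le:
  fixes a b c :: real
  assumes "0 < a" "0 < b" "0 < c" "a\<^sup>2 \<le> b * c"
  shows "2 * ln a \<le> ln b + ln c"
proof -
  have "ln (a\<^sup>2) \<le> ln (b * c)" using assms by (subst ln_le_cancel_iff) auto
  then show ?thesis using assms by (simp add: ln_mult ln_realpow)
qed

lemma smult_mult_adjoint: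
  fixes Y Z :: "complex mat"
  assumes "Y \<in> carrier_mat n n" "Z \<in> carrier_mat n n"
  shows "(complex_of_real p \<cdot>\<^sub>m Y) * (complex_of_real q \<cdot>\<^sub>m Z)\<^sup>\<dagger> = complex_of_real (p * q) \<cdot>\<^sub>m (Y * Z\<^sup>\<dagger>)"
  using assms
  by (simp add: adjoint_smult mult_smult_distrib[of _ n n _ n] mult_smult_assoc_mat[of _ n n _ n]
      mult_carrier_mat[of _ n n _ n]; intro eq_matI; simp add: mult_ac)

text \<open>The diagonal of the triangular form of \<open>Y Z\<^sup>\<dagger>\<close> consists of
  the eigenvalues of \<open>X\<close>, and each is the inner product of row \<open>j\<close> of
  \<open>p\<close> with row \<open>j\<close> of \<open>q\<close>. Cauchy-Schwarz is used within each
  row and again over the rows; Peierls' inequality in the common basis \<open>V\<close> then bounds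
  both factors.\<close>

lemma trpow_cauchy_schwarz_ge_1:
  assumes Y: "Y \<in> carrier_mat n n" and Z: "Z \<in> carrier_mat n n"
    and X: "psd n X" "char_poly (Y * Z\<^sup>\<dagger>) = char_poly X" and z: "1 \<le> z"
  shows "(trpow X z)\<^sup>2 \<le> trpow (Y * Y\<^sup>\<dagger>) z * trpow (Z * Z\<^sup>\<dagger>) z"
proof -
  have M: "Y * Z\<^sup>\<dagger> \<in> carrier_mat n n" using Y Z by (simp add: mult_carrier_mat[of _ n n _ n])
  obtain W x where W: "unitary n W" and XW: "X = wdiag n W x" using psd_spectral[OF X(1)] by blast
  have x: "0 \<le> x i" if "i < n" for i by (rule psd_eigenvalues_nonneg[OF X(1) W XW that])
  have "char_poly (Y * Z\<^sup>\<dagger>) = (\<Prod>a\<leftarrow>map (\<lambda>i. complex_of_real (x i)) [0..<n]. [:- a, 1:])"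
    unfolding X(2) XW by (rule char_poly_wdiag[OF W])
  from schur_conj[OF M this] obtain V T where V: "unitary n V" and T: "T \<in> carrier_mat n n"
    "diag_mat T = map (\<lambda>i. complex_of_real (x i)) [0..<n]" "V\<^sup>\<dagger> * (Y * Z\<^sup>\<dagger>) * V = T" by metis
  note Vc [simp] = unitary_carrier[OF V] and Y [simp] and Z [simp]
  define p q where "p = V\<^sup>\<dagger> * Y" and "q = V\<^sup>\<dagger> * Z"
  have c: "p \<in> carrier_mat n n" "q \<in> carrier_mat n n"
    by (simp_all add: p_def q_def mult_carrier_mat[of _ n n _ n])
  define u v where "u j = (\<Sum>k<n. (cmod (p $$ (j,k)))\<^sup>2)" and "v j = (\<Sum>k<n. (cmod (q $$ (j,k)))\<^sup>2)" for j
  have sq: "(f * f\<^sup>\<dagger>) $$ (j,j) = complex_of_real (\<Sum>k<n. (cmod (f $$ (j,k)))\<^sup>2)"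
    if f: "f \<in> carrier_mat n n" and j: "j < n" for f :: "complex mat" and j
    unfolding mult_adjoint_index[OF f f j j] by (simp only: complex_norm_square[symmetric] of_real_sum)
  have u: "(V\<^sup>\<dagger> * (Y * Y\<^sup>\<dagger>) * V) $$ (j,j) = complex_of_real (u j)" if "j < n" for j
    unfolding conj_mult_adjoint[OF Vc Y Y] p_def[symmetric] sq[OF c(1) that] u_def ..
  have v: "(V\<^sup>\<dagger> * (Z * Z\<^sup>\<dagger>) * V) $$ (j,j) = complex_of_real (v j)" if "j < n" for j
    unfolding conj_mult_adjoint[OF Vc Z Z] q_def[symmetric] sq[OF c(2) that] v_def ..
  have nn: "0 \<le> u j" "0 \<le> v j" for j by (auto simp: u_def v_def intro!: sum_nonneg)
  have "x j powr z \<le> u j powr (z / 2) * v j powr (z / 2)" if j: "j < n" for j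
  proof -
    have "complex_of_real (x j) = T $$ (j,j)"
      using arg_cong[OF T(2), of "\<lambda>l. l ! j"] j carrier_matD[OF T(1)] by (simp add: diag_mat_def)
    also have "\<dots> = (\<Sum>k<n. p $$ (j,k) * cnj (q $$ (j,k)))"
      unfolding T(3)[symmetric] conj_mult_adjoint[OF Vc Y Z] p_def[symmetric] q_def[symmetric]
      by (rule mult_adjoint_index[OF c j j])
    finally have "x j = cmod (\<Sum>k<n. p $$ (j,k) * cnj (q $$ (j,k)))"
      using x[OF j] by (metis norm_of_real abs_of_nonneg)
    also have "\<dots> \<le> (\<Sum>k<n. cmod (p $$ (j,k)) * cmod (q $$ (j,k)))"
      by (rule order_trans[OF norm_sum]) (simp add: norm_mult)
    finally have "(x j)\<^sup>2 \<le> (\<Sum>k<n. cmod (p $$ (j,k)) * cmod (q $$ (j,k)))\<^sup>2"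
      using x[OF j] by (intro power_mono)
    also have "\<dots> \<le> u j * v j" unfolding u_def v_def by (rule Cauchy_Schwarz_ineq_sum)
    finally have "((x j)\<^sup>2) powr (z / 2) \<le> (u j * v j) powr (z / 2)"
      using z by (intro powr_mono2) auto
    moreover have "((x j)\<^sup>2) powr (z / 2) = x j powr z"
      using x[OF j] by (cases "x j = 0") (simp_all add: powr_powr flip: powr_numeral)
    ultimately show ?thesis using nn by (simp add: powr_mult)
  qed
  then have "trpow X z \<le> (\<Sum>j<n. u j powr (z / 2) * v j powr (z / 2))"
    unfolding trpow_wdiag[OF X(1) W XW] by (intro sum_mono) auto
  then have "(trpow X z)\<^sup>2 \<le> (\<Sum>j<n. u j powr (z / 2) * v j powr (z / 2))\<^sup>2"
    unfolding trpow_wdiag[OF X(1) W XW] by (intro power_mono) (auto intro!: sum_nonneg)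
  also have "\<dots> \<le> (\<Sum>j<n. (u j powr (z / 2))\<^sup>2) * (\<Sum>j<n. (v j powr (z / 2))\<^sup>2)"
    by (rule Cauchy_Schwarz_ineq_sum)
  also have "(\<Sum>j<n. (u j powr (z / 2))\<^sup>2) = (\<Sum>j<n. Re ((V\<^sup>\<dagger> * (Y * Y\<^sup>\<dagger>) * V) $$ (j,j)) powr z)"
    by (intro sum.cong) (auto simp: u power2_eq_square simp flip: powr_add simp del: index_mult_mat)
  also have "(\<Sum>j<n. (v j powr (z / 2))\<^sup>2) = (\<Sum>j<n. Re ((V\<^sup>\<dagger> * (Z * Z\<^sup>\<dagger>) * V) $$ (j,j)) powr z)"
    by (intro sum.cong) (auto simp: v power2_eq_square simp flip: powr_add simp del: index_mult_mat)
  also have "(\<Sum>j<n. Re ((V\<^sup>\<dagger> * (Y * Y\<^sup>\<dagger>) * V) $$ (j,j)) powr z)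
      * (\<Sum>j<n. Re ((V\<^sup>\<dagger> * (Z * Z\<^sup>\<dagger>) * V) $$ (j,j)) powr z)
      \<le> trpow (Y * Y\<^sup>\<dagger>) z * trpow (Z * Z\<^sup>\<dagger>) z"
    by (intro mult_mono peierls[OF _ V z] psd_mult_adjoint Y Z sum_nonneg
        order_trans[OF _ peierls[OF psd_mult_adjoint[OF Y] V z]]) auto
  finally show ?thesis .
qed

text \<open>Taking logarithms of the determinant inequality and integrating gives only an additive
  bound. Giving \<open>Y\<close> and \<open>Z\<close> different scalings yields this bound for a
  whole family of parameters \<open>s\<close>, and optimizing over it recovers the product
  form.\<close>

lemma trpow_cauchy_schwarz_less_1:
  assumes Y: "Y \<in> carrier_mat n n" and Z: "Z \<in> carrier_mat n n"
    and X: "psd n X" "char_poly (Y * Z\<^sup>\<dagger>) = char_poly X" and z: "0 < z" "z < 1"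
  shows "(trpow X z)\<^sup>2 \<le> trpow (Y * Y\<^sup>\<dagger>) z * trpow (Z * Z\<^sup>\<dagger>) z"
proof -
  have M: "Y * Z\<^sup>\<dagger> \<in> carrier_mat n n" using Y Z by (simp add: mult_carrier_mat[of _ n n _ n])
  note YY = psd_mult_adjoint[OF Y] and ZZ = psd_mult_adjoint[OF Z]
  obtain W x where W: "unitary n W" and XW: "X = wdiag n W x" using psd_spectral[OF X(1)] by blast
  obtain U b where U: "unitary n U" "Y * Y\<^sup>\<dagger> = wdiag n U b" using psd_spectral[OF YY] by blast
  obtain V c where V: "unitary n V" "Z * Z\<^sup>\<dagger> = wdiag n V c" using psd_spectral[OF ZZ] by blast
  note Uc = unitary_carrier[OF U(1)] and Vc = unitary_carrier[OF V(1)]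
  have x: "0 \<le> x i" if "i < n" for i by (rule psd_eigenvalues_nonneg[OF X(1) W XW that])
  have b: "0 \<le> b i" if "i < n" for i by (rule psd_eigenvalues_nonneg[OF YY U that])
  have c: "0 \<le> c i" if "i < n" for i by (rule psd_eigenvalues_nonneg[OF ZZ V that])
  have main: "2 * trpow X z \<le> s powr z * trpow (Y * Y\<^sup>\<dagger>) z + trpow (Z * Z\<^sup>\<dagger>) z / s powr z" if s: "s > 0" for s
  proof -
    have "2 * (\<Sum>i<n. x i powr z) \<le> (\<Sum>i<n. (s * b i) powr z) + (\<Sum>i<n. (c i / s) powr z)"
    proof (rule sum_powr_le_of_sum_ln_le[OF z])
      fix t :: real assume t: "t > 0"
      \<comment> \<open>The scalings are chosen so that \<open>?Y * ?Z\<^sup>\<dagger>\<close>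
        carries the factor \<open>t\<close> alone, while \<open>s\<close> and its inverse appear in
        the two Gram matrices.\<close>
      let ?Y = "complex_of_real (sqrt (t * s)) \<cdot>\<^sub>m Y" and ?Z = "complex_of_real (sqrt (t / s)) \<cdot>\<^sub>m Z"
      have "sqrt (t * s) * sqrt (t / s) = t"
        using t s by (simp add: real_sqrt_mult real_sqrt_divide)
      moreover have "sqrt (t * s) * sqrt (t * s) = t * s" "sqrt (t / s) * sqrt (t / s) = t / s"
        using t s by simp_all
      ultimately have sq: "sqrt (t * s) * sqrt (t * s) = t * s" "sqrt (t / s) * sqrt (t / s) = t / s"
        "sqrt (t * s) * sqrt (t / s) = t" by blast+
      have 1: "?Y * ?Y\<^sup>\<dagger> = wdiag n U (\<lambda>i. t * s * b i)"
        unfolding smult_mult_adjoint[OF Y Y] sq U(2) by (rule wdiag_smult[OF Uc])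
      have 2: "?Z * ?Z\<^sup>\<dagger> = wdiag n V (\<lambda>i. t / s * c i)"
        unfolding smult_mult_adjoint[OF Z Z] sq V(2) by (rule wdiag_smult[OF Vc])
      have "(cmod (det (1\<^sub>m n + ?Y * ?Z\<^sup>\<dagger>)))\<^sup>2 \<le> (\<Prod>i<n. 1 + t * s * b i) * (\<Prod>i<n. 1 + t / s * c i)"
        by (rule det_cauchy_schwarz[OF _ _ U(1) 1 V(1) 2]) (use Y Z in auto)
      also have "det (1\<^sub>m n + ?Y * ?Z\<^sup>\<dagger>) = complex_of_real (\<Prod>i<n. 1 + t * x i)"
        unfolding smult_mult_adjoint[OF Y Z] sq by (rule det_one_plus_smult[OF M W]) (simp add: X(2) XW)
      finally have le: "(\<Prod>i<n. 1 + t * x i)\<^sup>2 \<le> (\<Prod>i<n. 1 + t * s * b i) * (\<Prod>i<n. 1 + t / s * c i)"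
        by (simp only: norm_of_real power2_abs)
      have px: "0 < 1 + t * x i" and pb: "0 < 1 + t * s * b i" and pc: "0 < 1 + t / s * c i" if "i < n" for i
        using x[OF that] b[OF that] c[OF that] t s by (auto intro!: add_pos_nonneg)
      have P: "0 < (\<Prod>i<n. 1 + t * x i)" "0 < (\<Prod>i<n. 1 + t * s * b i)" "0 < (\<Prod>i<n. 1 + t / s * c i)"
        using px pb pc by (auto intro!: prod_pos)
      have le': "2 * ln (\<Prod>i<n. 1 + t * x i) \<le> ln (\<Prod>i<n. 1 + t * s * b i) + ln (\<Prod>i<n. 1 + t / s * c i)"
        by (rule two_ln_le[OF P le])
      show "2 * (\<Sum>i<n. ln (1 + t * x i)) \<le> (\<Sum>i<n. ln (1 + t * (s * b i))) + (\<Sum>i<n. ln (1 + t * (c i / s)))"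
      proof -
        have "ln (\<Prod>i<n. f i) = (\<Sum>i<n. ln (f i))" if "\<And>i. i < n \<Longrightarrow> 0 < f i" for f :: "nat \<Rightarrow> real"
          by (rule ln_prod) (use that in fastforce)+
        from le' this[OF px] this[OF pb] this[OF pc] show ?thesis by (simp add: mult.assoc)
      qed
    qed (use x b c s in auto)
    also have "(\<Sum>i<n. (s * b i) powr z) = s powr z * trpow (Y * Y\<^sup>\<dagger>) z"
      unfolding trpow_wdiag[OF YY U] sum_distrib_left
      using s b by (intro sum.cong) (auto simp: powr_mult)
    also have "(\<Sum>i<n. (c i / s) powr z) = trpow (Z * Z\<^sup>\<dagger>) z / s powr z"
      unfolding trpow_wdiag[OF ZZ V] sum_divide_distrib
      using s c by (intro sum.cong) (auto simp: powr_divide)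
    finally show ?thesis unfolding trpow_wdiag[OF X(1) W XW] .
  qed
  show ?thesis
  proof (rule sq_le_mult_of_scaled)
    fix r :: real assume r: "r > 0"
    then have "(r powr (1 / z)) powr z = r" using z by (simp add: powr_powr)
    with main[of "r powr (1 / z)"] r
    show "2 * trpow X z \<le> r * trpow (Y * Y\<^sup>\<dagger>) z + trpow (Z * Z\<^sup>\<dagger>) z / r" by simp
  qed (auto simp: trpow_wdiag[OF X(1) W XW] trpow_wdiag[OF YY U] trpow_wdiag[OF ZZ V] intro!: sum_nonneg)
qed

text \<open>The product \<open>Y Z\<^sup>\<dagger>\<close> need not be Hermitian; \<open>X\<close> only records that its spectrum is nonnegative.\<close>

theorem trpow_cauchy_schwarz:
  assumes "Y \<in> carrier_mat n n" "Z \<in> carrier_mat n n"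
    and "psd n X" "char_poly (Y * Z\<^sup>\<dagger>) = char_poly X" and "0 < z"
  shows "(trpow X z)\<^sup>2 \<le> trpow (Y * Y\<^sup>\<dagger>) z * trpow (Z * Z\<^sup>\<dagger>) z"
  using trpow_cauchy_schwarz_ge_1[OF assms(1-4)] trpow_cauchy_schwarz_less_1[OF assms(1-4)] assms(5)
  by (cases "1 \<le> z") auto

text \<open>Every point of the unit interval is the midpoint of an endpoint and another point of the
  interval. As \<open>g\<close> is nonpositive at the endpoints, each such step halves the upper
  bound, which therefore tends to 0.\<close>

lemma midconvex_nonpos:
  fixes g :: "real \<Rightarrow> real"
  assumes mid: "\<And>x y. g ((x + y) / 2) \<le> (g x + g y) / 2"
    and bdd: "\<And>x. 0 \<le> x \<Longrightarrow> x \<le> 1 \<Longrightarrow> g x \<le> M"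
    and ends: "g 0 \<le> 0" "g 1 \<le> 0" and x: "0 \<le> x" "x \<le> 1"
  shows "g x \<le> 0"
proof -
  define K where "K = max M 0"
  have step: "g x \<le> K / 2 ^ k" if "0 \<le> x" "x \<le> 1" for x k
    using that
  proof (induction k arbitrary: x)
    case 0
    then show ?case using bdd[of x] by (simp add: K_def)
  next
    case (Suc k)
    show ?case
    proof (cases "x \<le> 1 / 2")
      case True
      have "g x \<le> (g 0 + g (2 * x)) / 2" using mid[of 0 "2 * x"] by simp
      also have "\<dots> \<le> (0 + K / 2 ^ k) / 2"
        using Suc.IH[of "2 * x"] Suc.prems True ends by (intro divide_right_mono add_mono) auto
      finally show ?thesis by (simp add: mult.commute)
    next
      case False
      have "g x \<le> (g 1 + g (2 * x - 1)) / 2" using mid[of 1 "2 * x - 1"] by simp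
      also have "\<dots> \<le> (0 + K / 2 ^ k) / 2"
        using Suc.IH[of "2 * x - 1"] Suc.prems False ends by (intro divide_right_mono add_mono) auto
      finally show ?thesis by (simp add: mult.commute)
    qed
  qed
  have "(\<lambda>k. K / 2 ^ k) \<longlonglongrightarrow> 0"
    by (rule LIMSEQ_divide_realpow_zero) simp
  then show ?thesis
    by (rule Lim_bounded2) (use step[OF x] in auto)
qed

text \<open>Subtracting the affine interpolant \<open>L\<close> from \<open>ln f\<close> along the
  segment gives a midpoint convex \<open>g\<close> that vanishes at both ends; boundedness above on
  segments takes the place of continuity.\<close>

lemma midpoint_log_convex:
  fixes f :: "real \<Rightarrow> real"
  assumes pos: "\<And>x. 0 < f x"
    and mid: "\<And>x y. (f ((x + y) / 2))\<^sup>2 \<le> f x * f y"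
    and bdd: "\<And>x y. \<exists>M. \<forall>u. 0 \<le> u \<and> u \<le> 1 \<longrightarrow> f (u * x + (1 - u) * y) \<le> M"
    and \<theta>: "0 \<le> \<theta>" "\<theta> \<le> 1"
  shows "f (\<theta> * x + (1 - \<theta>) * y) \<le> f x powr \<theta> * f y powr (1 - \<theta>)"
proof -
  define L where "L u = u * ln (f x) + (1 - u) * ln (f y)" for u
  define g where "g u = ln (f (u * x + (1 - u) * y)) - L u" for u
  have lmid: "ln (f ((x + y) / 2)) \<le> (ln (f x) + ln (f y)) / 2" for x y
  proof -
    show ?thesis using two_ln_le[OF pos pos pos mid[of x y]] by simp
  qed
  obtain M where M: "\<And>u. 0 \<le> u \<Longrightarrow> u \<le> 1 \<Longrightarrow> f (u * x + (1 - u) * y) \<le> M"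
    using bdd[of x y] by blast
  have "g \<theta> \<le> 0"
  proof (rule midconvex_nonpos[where g = g and x = \<theta> and M = "ln M + \<bar>ln (f x)\<bar> + \<bar>ln (f y)\<bar>"])
    fix u v :: real
    have "(u + v) / 2 * x + (1 - (u + v) / 2) * y = ((u * x + (1 - u) * y) + (v * x + (1 - v) * y)) / 2"
      by (simp add: field_simps)
    then have "ln (f ((u + v) / 2 * x + (1 - (u + v) / 2) * y))
        \<le> (ln (f (u * x + (1 - u) * y)) + ln (f (v * x + (1 - v) * y))) / 2"
      using lmid by metis
    moreover have "L ((u + v) / 2) = (L u + L v) / 2" by (simp add: L_def field_simps)
    ultimately show "g ((u + v) / 2) \<le> (g u + g v) / 2"
      unfolding g_def by (simp add: field_simps)
  next
    fix u :: real assume u: "0 \<le> u" "u \<le> 1"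
    have "ln (f (u * x + (1 - u) * y)) \<le> ln M"
      using M[OF u] pos[of "u * x + (1 - u) * y"] by (subst ln_le_cancel_iff) (auto intro: less_le_trans)
    moreover have "\<bar>u * ln (f x)\<bar> \<le> \<bar>ln (f x)\<bar>" "\<bar>(1 - u) * ln (f y)\<bar> \<le> \<bar>ln (f y)\<bar>"
      using u by (auto simp: abs_mult intro!: mult_left_le_one_le)
    ultimately show "g u \<le> ln M + \<bar>ln (f x)\<bar> + \<bar>ln (f y)\<bar>"
      unfolding g_def L_def by linarith
  qed (use \<theta> in \<open>auto simp: g_def L_def\<close>)
  then have "ln (f (\<theta> * x + (1 - \<theta>) * y)) \<le> ln (f x powr \<theta> * f y powr (1 - \<theta>))"
    using pos[of x] pos[of y] by (simp add: g_def L_def ln_mult ln_powr)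
  then show ?thesis
    using pos[of x] pos[of y] pos[of "\<theta> * x + (1 - \<theta>) * y"]
    by (subst (asm) ln_le_cancel_iff) auto
qed

section \<open>Two positive semidefinite matrices in their eigenbases\<close>

lemma trpow_nonneg:
  assumes "psd n X"
  shows "0 \<le> trpow X z"
proof -
  obtain W x where "unitary n W" "X = wdiag n W x" using psd_spectral[OF assms] by blast
  then show ?thesis by (subst trpow_wdiag[OF assms]) (auto intro!: sum_nonneg)
qed

lemma trpow_1:
  assumes X: "psd n X"
  shows "trpow X 1 = Re (mtrace X)"
proof -
  obtain W x where W: "unitary n W" and XW: "X = wdiag n W x" using psd_spectral[OF X] by blast
  have "trpow X 1 = (\<Sum>i<n. x i)"
    unfolding trpow_wdiag[OF X W XW] using psd_eigenvalues_nonneg[OF X W XW] by (intro sum.cong) auto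
  then show ?thesis by (simp add: XW mtrace_wdiag[OF W])
qed

text \<open>Both sides say that some eigenvalue is nonzero, whatever the exponent. Positivity of a
  trace of powers is thus decided by the trace itself, which is linear and easy to compute.\<close>

lemma trpow_pos_iff:
  assumes X: "psd n X"
  shows "0 < trpow X z \<longleftrightarrow> 0 < Re (mtrace X)"
proof -
  obtain W x where W: "unitary n W" and XW: "X = wdiag n W x" using psd_spectral[OF X] by blast
  have *: "0 < trpow X z \<longleftrightarrow> (\<exists>i<n. x i \<noteq> 0)" for z
  proof -
    have "trpow X z = 0 \<longleftrightarrow> (\<forall>i<n. x i = 0)"
      unfolding trpow_wdiag[OF X W XW] by (subst sum_nonneg_eq_0_iff) auto
    then show ?thesis using trpow_nonneg[OF X, of z] by (auto simp: less_le)
  qed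
  then show ?thesis using trpow_1[OF X] by metis
qed

lemma trpow_le_mtrace:
  assumes X: "psd n X" and z: "0 < z"
  shows "trpow X z \<le> n * Re (mtrace X) powr z"
proof -
  obtain W x where W: "unitary n W" and XW: "X = wdiag n W x" using psd_spectral[OF X] by blast
  note x = psd_eigenvalues_nonneg[OF X W XW]
  have "x i powr z \<le> (\<Sum>i<n. x i) powr z" if "i < n" for i
    using that x z by (intro powr_mono2 member_le_sum) auto
  then have "(\<Sum>i<n. x i powr z) \<le> (\<Sum>i<n. (\<Sum>i<n. x i) powr z)" by (intro sum_mono) auto
  then show ?thesis unfolding trpow_wdiag[OF X W XW] by (simp add: XW mtrace_wdiag[OF W])
qed

lemma unitary_cancel_left:
  assumes "unitary n U" "X \<in> carrier_mat n k"
  shows "U\<^sup>\<dagger> * (U * X) = X"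
proof -
  note c = unitary_carrier[OF assms(1)]
  have "U\<^sup>\<dagger> * (U * X) = (U\<^sup>\<dagger> * U) * X"
    by (rule assoc_mult_mat[OF adjoint_carrier[OF c] c assms(2), symmetric])
  then show ?thesis using assms by (simp add: unitary_left)
qed

section \<open>Diagonal entries and traces in a unitary basis\<close>

lemma conj_wdiag_left_index:
  assumes U: "unitary n U" and M: "M \<in> carrier_mat n n" and j: "j < n"
  shows "(U\<^sup>\<dagger> * (wdiag n U d * M) * U) $$ (j,j) = complex_of_real (d j) * (U\<^sup>\<dagger> * M * U) $$ (j,j)"
proof -
  note [simp] = unitary_carrier[OF U] M
  have "U\<^sup>\<dagger> * (wdiag n U d * M) * U = mat_diag n (\<lambda>i. complex_of_real (d i)) * (U\<^sup>\<dagger> * M * U)"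
    unfolding wdiag_def
    by (simp add: assoc_mult_mat[of _ n n _ n _ n] mult_carrier_mat[of _ n n _ n]
        unitary_cancel_left[OF U, of _ n])
  also have "\<dots> = mat n n (\<lambda>(i,j). complex_of_real (d i) * (U\<^sup>\<dagger> * M * U) $$ (i,j))"
    by (rule mat_diag_mult_left) (simp add: mult_carrier_mat[of _ n n _ n])
  finally show ?thesis using j by (simp del: index_mult_mat)
qed

lemma conj_wdiag_right_index:
  assumes U: "unitary n U" and M: "M \<in> carrier_mat n n" and j: "j < n"
  shows "(U\<^sup>\<dagger> * (M * wdiag n U d) * U) $$ (j,j) = (U\<^sup>\<dagger> * M * U) $$ (j,j) * complex_of_real (d j)"
proof -
  note [simp] = unitary_carrier[OF U] M
  have "U\<^sup>\<dagger> * (M * wdiag n U d) * U = (U\<^sup>\<dagger> * M * U) * mat_diag n (\<lambda>i. complex_of_real (d i))"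
    unfolding wdiag_def
    by (simp add: assoc_mult_mat[of _ n n _ n _ n] mult_carrier_mat[of _ n n _ n]
        unitary_left[OF U] right_mult_one_mat[of _ n n])
  also have "\<dots> = mat n n (\<lambda>(i,j). (U\<^sup>\<dagger> * M * U) $$ (i,j) * complex_of_real (d j))"
    by (rule mat_diag_mult_right) (simp add: mult_carrier_mat[of _ n n _ n])
  finally show ?thesis using j by (simp del: index_mult_mat)
qed

lemma conj_minus_index:
  assumes U: "U \<in> carrier_mat n n" and A: "A \<in> carrier_mat n n" and B: "B \<in> carrier_mat n n" and j: "j < n"
  shows "(U\<^sup>\<dagger> * (A - B) * U) $$ (j,j) = (U\<^sup>\<dagger> * A * U) $$ (j,j) - (U\<^sup>\<dagger> * (B :: complex mat) * U) $$ (j,j)"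
proof -
  note [simp] = U A B
  have "U\<^sup>\<dagger> * (A - B) * U = U\<^sup>\<dagger> * A * U - U\<^sup>\<dagger> * B * U"
    by (simp add: mult_minus_distrib_mat[of _ n n _ n] minus_mult_distrib_mat[of _ n n _ _ n]
        mult_carrier_mat[of _ n n _ n])
  then show ?thesis using j carrier_matD[OF U] by (simp del: index_mult_mat(1))
qed

lemma mtrace_conj:
  assumes U: "unitary n U" and M: "M \<in> carrier_mat n n"
  shows "mtrace M = (\<Sum>j<n. (U\<^sup>\<dagger> * M * U) $$ (j,j))"
proof -
  note [simp] = unitary_carrier[OF U] M
  have c: "M * U \<in> carrier_mat n n" "U\<^sup>\<dagger> * M * U \<in> carrier_mat n n"
    by (simp_all add: mult_carrier_mat[of _ n n _ n])
  have "mtrace (U\<^sup>\<dagger> * M * U) = mtrace (U\<^sup>\<dagger> * (M * U))"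
    by (simp add: assoc_mult_mat[of _ n n _ n _ n])
  also have "\<dots> = mtrace (M * U * U\<^sup>\<dagger>)" by (rule mtrace_mult_commute[of _ n]) (use c in auto)
  also have "M * U * U\<^sup>\<dagger> = M"
    by (simp add: assoc_mult_mat[of _ n n _ n _ n] unitary_right[OF U] right_mult_one_mat[of _ n n])
  finally show ?thesis using carrier_matD[OF c(2)] by (simp add: mtrace_def del: index_mult_mat(1))
qed

text \<open>A crude consequence of convexity of the exponential, sufficient for local boundedness in
  the exponent.\<close>

lemma powr_convex_combination_le:
  fixes a p q u :: real
  assumes "0 \<le> a" "0 \<le> u" "u \<le> 1"
  shows "a powr (u * p + (1 - u) * q) \<le> a powr p + a powr q"
proof (cases "a = 0")
  case False
  with assms have a: "a > 0" by simp
  have "a powr (u * p + (1 - u) * q) = exp ((1 - u) * (q * ln a) + u * (p * ln a))"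
    using a by (simp add: powr_def algebra_simps)
  also have "\<dots> \<le> (1 - u) * exp (q * ln a) + u * exp (p * ln a)"
    using convex_onD[OF exp_convex, of u "q * ln a" "p * ln a"] assms by simp
  also have "\<dots> \<le> 1 * exp (q * ln a) + 1 * exp (p * ln a)"
    using assms by (intro add_mono mult_right_mono) auto
  finally show ?thesis using a by (simp add: powr_def)
qed simp

text \<open>The eigenbases are fixed once, and the \<open>matfun\<close> assumptions tie them to the
  choice made inside \<open>matfun\<close>, so that powers, supports and logarithms are all diagonal
  in the same two bases.\<close>

locale psd_pair =
  fixes m :: nat and \<rho> \<sigma> U V :: "complex mat" and r s :: "nat \<Rightarrow> real"
  assumes \<rho>: "psd m \<rho>" and \<sigma>: "psd m \<sigma>"
    and U: "unitary m U" and \<rho>_eq: "\<rho> = wdiag m U r"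
    and r: "\<And>i. i < m \<Longrightarrow> 0 \<le> r i" and matfun_\<rho>: "\<And>f. matfun f \<rho> = wdiag m U (\<lambda>i. f (r i))"
    and V: "unitary m V" and \<sigma>_eq: "\<sigma> = wdiag m V s"
    and s: "\<And>i. i < m \<Longrightarrow> 0 \<le> s i" and matfun_\<sigma>: "\<And>f. matfun f \<sigma> = wdiag m V (\<lambda>i. f (s i))"
begin

lemmas Uc [simp] = unitary_carrier[OF U]
lemmas Vc [simp] = unitary_carrier[OF V]

text \<open>The squared overlap of eigenvector \<open>j\<close> of \<rho> with eigenvector
  \<open>k\<close> of \<sigma>.\<close>

definition w :: "nat \<Rightarrow> nat \<Rightarrow> real" where
  "w j k = (cmod ((U\<^sup>\<dagger> * V) $$ (j,k)))\<^sup>2"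

lemma w_nonneg [simp]: "0 \<le> w j k"
  by (simp add: w_def)

lemma w_row_sum: "j < m \<Longrightarrow> (\<Sum>k<m. w j k) = 1"
  unfolding w_def by (intro unitary_row_sum unitary_mult unitary_adjoint U V)

lemma conj_wdiag_V_index:
  assumes "j < m"
  shows "(U\<^sup>\<dagger> * wdiag m V d * U) $$ (j,j) = complex_of_real (\<Sum>k<m. d k * w j k)"
  unfolding wdiag_conj[OF Uc Vc] w_def
  by (rule wdiag_diag_index[OF mult_carrier_mat[OF adjoint_carrier[OF Uc] Vc] assms])

lemma mpow_\<rho>: "mpow \<rho> c = wdiag m U (\<lambda>i. r i powr c)"
  by (simp add: mpow_def matfun_\<rho>)

lemma mpow_\<sigma>: "mpow \<sigma> c = wdiag m V (\<lambda>i. s i powr c)"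
  by (simp add: mpow_def matfun_\<sigma>)

lemma mpow_carrier [simp]: "mpow \<rho> c \<in> carrier_mat m m" "mpow \<sigma> c \<in> carrier_mat m m"
  by (simp_all add: mpow_\<rho> mpow_\<sigma>)

lemma mpow_adjoint [simp]: "(mpow \<rho> c)\<^sup>\<dagger> = mpow \<rho> c" "(mpow \<sigma> c)\<^sup>\<dagger> = mpow \<sigma> c"
  by (simp_all add: mpow_\<rho> mpow_\<sigma> wdiag_adjoint)

text \<open>Since \<open>0 powr c = 0\<close> for every \<open>c\<close>, the exponent law holds for all real exponents, zero and
  negative ones included.\<close>

lemma mpow_add: "mpow \<rho> a * mpow \<rho> b = mpow \<rho> (a + b)" "mpow \<sigma> a * mpow \<sigma> b = mpow \<sigma> (a + b)"
  by (simp_all add: mpow_\<rho> mpow_\<sigma> wdiag_mult[OF U] wdiag_mult[OF V] powr_add)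

lemma mpow_add_left:
  assumes "X \<in> carrier_mat m m"
  shows "mpow \<rho> a * (mpow \<rho> b * X) = mpow \<rho> (a + b) * X" "mpow \<sigma> a * (mpow \<sigma> b * X) = mpow \<sigma> (a + b) * X"
  using assms by (simp_all flip: assoc_mult_mat[of _ m m _ m _ m] add: mpow_add)

lemmas mult_simps = assoc_mult_mat[of _ m m _ m _ m] mult_carrier_mat[of _ m m _ m] adjoint_mult[of _ m m _ m]
  mpow_add mpow_add_left

definition sandwich :: "real \<Rightarrow> real \<Rightarrow> complex mat" where
  "sandwich c d = mpow \<rho> c * mpow \<sigma> d * mpow \<rho> c"

lemma sandwich_psd: "psd m (sandwich c d)"
proof -
  have "psd m (mpow \<sigma> d)" unfolding mpow_\<sigma> by (rule wdiag_psd[OF V]) simp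
  from psd_congruence[OF this mpow_carrier(1), of c] show ?thesis by (simp add: sandwich_def)
qed

lemma sandwich_carrier [simp]: "sandwich c d \<in> carrier_mat m m"
  by (rule psd_carrier[OF sandwich_psd])

lemma mult_adjoint_eq_sandwich:
  "(mpow \<rho> c * mpow \<sigma> d) * (mpow \<rho> c * mpow \<sigma> d)\<^sup>\<dagger> = sandwich c (d + d)"
  by (simp add: sandwich_def mult_simps)

text \<open>Cyclicity: only the sum of the outer exponents matters, so unequal ones may be replaced
  by their average.\<close>

lemma char_poly_sandwich:
  "char_poly (mpow \<rho> a * mpow \<sigma> d * mpow \<rho> b) = char_poly (mpow \<rho> (a + b) * mpow \<sigma> d)"
proof -
  have "char_poly (mpow \<rho> a * mpow \<sigma> d * mpow \<rho> b) = char_poly (mpow \<rho> b * (mpow \<rho> a * mpow \<sigma> d))"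
    by (rule char_poly_mult_commute[of _ m]) (simp_all add: mult_simps)
  then show ?thesis by (simp add: mult_simps add.commute)
qed

text \<open>\<open>?Y\<close> and \<open>?Z\<close> are square-root factors of the two sandwiches,
  and \<open>?Y * ?Z\<^sup>\<dagger>\<close> has the middle exponents except that its outer powers
  are unequal, which the spectrum does not notice.\<close>

lemma trpow_sandwich_midpoint:
  assumes z: "0 < z"
  shows "(trpow (sandwich ((c + c') / 2) ((d + d') / 2)) z)\<^sup>2
    \<le> trpow (sandwich c d) z * trpow (sandwich c' d') z"
proof -
  let ?Y = "mpow \<rho> c * mpow \<sigma> (d / 2)" and ?Z = "mpow \<rho> c' * mpow \<sigma> (d' / 2)"
  have "?Y * ?Z\<^sup>\<dagger> = mpow \<rho> c * mpow \<sigma> ((d + d') / 2) * mpow \<rho> c'"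
    by (simp add: mult_simps add_divide_distrib)
  then have "char_poly (?Y * ?Z\<^sup>\<dagger>) = char_poly (sandwich ((c + c') / 2) ((d + d') / 2))"
    by (simp only: sandwich_def char_poly_sandwich field_sum_of_halves)
  from trpow_cauchy_schwarz[OF _ _ sandwich_psd this z] show ?thesis
    by (simp add: mult_adjoint_eq_sandwich mult_carrier_mat[of _ m m _ m])
qed

text \<open>A case of the Araki-Lieb-Thirring inequality. The square of \<open>?S\<close> has the
  spectrum of \<open>?Y * ?Y\<close>, so the Cauchy-Schwarz inequality is applied to
  \<open>?Y\<close> and its adjoint, whose two Gram matrices are isospectral.\<close>

lemma trpow_sandwich_double:
  assumes z: "0 < z"
  shows "trpow (sandwich c d) (2 * z) \<le> trpow (sandwich (2 * c) (2 * d)) z"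
proof -
  let ?S = "sandwich c d" and ?Y = "mpow \<rho> (2 * c) * mpow \<sigma> d"
  have Yc: "?Y \<in> carrier_mat m m" by (simp add: mult_carrier_mat[of _ m m _ m])
  have SS: "psd m (?S * ?S)"
    using psd_mult_adjoint[OF sandwich_carrier, of c d] psd_adjoint[OF sandwich_psd, of c d] by simp
  obtain W x where W: "unitary m W" and SW: "?S = wdiag m W x" using psd_spectral[OF sandwich_psd] by blast
  have "?S * ?S = wdiag m W (\<lambda>i. x i * x i)" unfolding SW by (rule wdiag_mult[OF W])
  from trpow_wdiag[OF SS W this] have "trpow (?S * ?S) z = (\<Sum>i<m. (x i * x i) powr z)" .
  also have "\<dots> = (\<Sum>i<m. x i powr (2 * z))"
    using psd_eigenvalues_nonneg[OF sandwich_psd W SW]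
    by (intro sum.cong) (auto simp: powr_mult simp flip: powr_add)
  finally have eq: "trpow (?S * ?S) z = trpow ?S (2 * z)"
    by (simp add: trpow_wdiag[OF sandwich_psd W SW])
  let ?N = "mpow \<sigma> d * (mpow \<rho> (2 * c) * mpow \<sigma> d)"
  have N: "?N \<in> carrier_mat m m" by (simp add: mult_simps)
  have "char_poly (?Y * (?Y\<^sup>\<dagger>)\<^sup>\<dagger>) = char_poly (mpow \<rho> (2 * c) * ?N)" by (simp add: mult_simps)
  also have "\<dots> = char_poly (?N * mpow \<rho> (2 * c))"
    by (rule char_poly_mult_commute[OF _ N]) simp
  also have "\<dots> = char_poly (?N * mpow \<rho> c * mpow \<rho> c)" by (simp add: mult_simps)
  also have "\<dots> = char_poly (mpow \<rho> c * (?N * mpow \<rho> c))"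
    by (rule char_poly_mult_commute[of _ m]) (simp_all add: mult_simps)
  also have "mpow \<rho> c * (?N * mpow \<rho> c) = ?S * ?S" by (simp add: sandwich_def mult_simps)
  finally have "(trpow (?S * ?S) z)\<^sup>2 \<le> trpow (?Y * ?Y\<^sup>\<dagger>) z * trpow (?Y\<^sup>\<dagger> * (?Y\<^sup>\<dagger>)\<^sup>\<dagger>) z"
    by (intro trpow_cauchy_schwarz[OF Yc adjoint_carrier[OF Yc] SS _ z])
  also have "trpow (?Y\<^sup>\<dagger> * (?Y\<^sup>\<dagger>)\<^sup>\<dagger>) z = trpow (?Y * ?Y\<^sup>\<dagger>) z"
    by (rule trpow_char_poly[OF psd_mult_adjoint[OF adjoint_carrier[OF Yc]] psd_mult_adjoint[OF Yc]])
       (simp only: adjoint_adjoint char_poly_mult_commute[OF adjoint_carrier[OF Yc] Yc])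
  also have "?Y * ?Y\<^sup>\<dagger> = sandwich (2 * c) (2 * d)" unfolding mult_adjoint_eq_sandwich mult_2 ..
  finally have "(trpow ?S (2 * z))\<^sup>2 \<le> (trpow (sandwich (2 * c) (2 * d)) z)\<^sup>2"
    by (simp only: eq power2_eq_square)
  then show ?thesis by (rule power2_le_imp_le) (rule trpow_nonneg[OF sandwich_psd])
qed

text \<open>With \<open>?Y\<close> carrying the support projection of \<sigma> and \<open>?Z\<close>
  not, the quantity \<open>?t\<close> appears on both sides of Cauchy-Schwarz, and one factor
  cancels.\<close>

lemma trpow_sandwich_le:
  assumes z: "0 < z"
  shows "trpow (sandwich (1 / (2 * z)) 0) z \<le> (\<Sum>j<m. r j)"
proof -
  let ?c = "1 / (2 * z)"
  let ?Y = "mpow \<rho> ?c * mpow \<sigma> 0" and ?Z = "mpow \<rho> ?c" and ?t = "trpow (sandwich ?c 0) z"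
  have Yc: "?Y \<in> carrier_mat m m" by (simp add: mult_carrier_mat[of _ m m _ m])
  have "?Y * ?Z\<^sup>\<dagger> = sandwich ?c 0" by (simp add: sandwich_def)
  then have "?t\<^sup>2 \<le> trpow (?Y * ?Y\<^sup>\<dagger>) z * trpow (?Z * ?Z\<^sup>\<dagger>) z"
    by (intro trpow_cauchy_schwarz[OF Yc mpow_carrier(1) sandwich_psd _ z]) simp
  also have "?Y * ?Y\<^sup>\<dagger> = sandwich ?c 0" unfolding mult_adjoint_eq_sandwich by simp
  also have "trpow (?Z * ?Z\<^sup>\<dagger>) z = (\<Sum>j<m. r j)"
  proof -
    have "1 / (2 * z) + 1 / (2 * z) = 1 / z" using z by (simp add: field_simps)
    then have "?Z * ?Z\<^sup>\<dagger> = mpow \<rho> (1 / z)" by (simp only: mpow_adjoint mpow_add)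
    then have eq: "?Z * ?Z\<^sup>\<dagger> = wdiag m U (\<lambda>i. r i powr (1 / z))" by (simp only: mpow_\<rho>)
    have "psd m (?Z * ?Z\<^sup>\<dagger>)" by (rule psd_mult_adjoint) simp
    from trpow_wdiag[OF this U eq] have "trpow (?Z * ?Z\<^sup>\<dagger>) z = (\<Sum>j<m. (r j powr (1 / z)) powr z)" .
    also have "\<dots> = (\<Sum>j<m. r j)" using z r by (intro sum.cong) (auto simp: powr_powr)
    finally show ?thesis .
  qed
  finally have "?t * ?t \<le> ?t * (\<Sum>j<m. r j)" by (simp only: power2_eq_square)
  moreover have "0 \<le> ?t" "0 \<le> (\<Sum>j<m. r j)" using r by (auto intro!: trpow_nonneg[OF sandwich_psd] sum_nonneg)
  ultimately show ?thesis by (cases "?t = 0") (auto simp: mult_le_cancel_left)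
qed

lemma sandwich_diag_index:
  assumes j: "j < m"
  shows "(U\<^sup>\<dagger> * sandwich c d * U) $$ (j,j) = complex_of_real (r j powr (2 * c) * (\<Sum>k<m. s k powr d * w j k))"
proof -
  have "(U\<^sup>\<dagger> * sandwich c d * U) $$ (j,j)
      = complex_of_real (r j powr c) * (U\<^sup>\<dagger> * mpow \<sigma> d * U) $$ (j,j) * complex_of_real (r j powr c)"
    unfolding sandwich_def mpow_\<rho>[of c]
    by (simp only: conj_wdiag_left_index[OF U mpow_carrier(2) j]
        conj_wdiag_right_index[OF U mult_carrier_mat[OF wdiag_carrier[OF Uc] mpow_carrier(2)] j])
  also have "(U\<^sup>\<dagger> * mpow \<sigma> d * U) $$ (j,j) = complex_of_real (\<Sum>k<m. s k powr d * w j k)"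
    unfolding mpow_\<sigma> by (rule conj_wdiag_V_index[OF j])
  moreover have "r j powr (2 * c) = r j powr c * r j powr c" by (simp flip: powr_add)
  ultimately show ?thesis by (simp only: of_real_mult mult_ac)
qed

lemma mtrace_sandwich:
  "Re (mtrace (sandwich c d)) = (\<Sum>j<m. r j powr (2 * c) * (\<Sum>k<m. s k powr d * w j k))"
  unfolding mtrace_conj[OF U sandwich_carrier]
  by (simp add: sandwich_diag_index del: index_mult_mat of_real_mult of_real_sum)

text \<open>Non-orthogonality of the supports, read off in the two eigenbases.\<close>

definition overlap :: bool where
  "overlap \<longleftrightarrow> (\<exists>j<m. \<exists>k<m. 0 < r j \<and> 0 < s k \<and> 0 < w j k)"

lemma mtrace_sandwich_pos_iff: "0 < Re (mtrace (sandwich c d)) \<longleftrightarrow> overlap"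
proof -
  have 1: "0 \<le> (\<Sum>k<m. s k powr d * w j k)" for j by (rule sum_nonneg) simp
  have "Re (mtrace (sandwich c d)) = 0 \<longleftrightarrow> (\<forall>j<m. r j powr (2 * c) * (\<Sum>k<m. s k powr d * w j k) = 0)"
    unfolding mtrace_sandwich using 1 by (subst sum_nonneg_eq_0_iff) auto
  also have "\<dots> \<longleftrightarrow> (\<forall>j<m. r j = 0 \<or> (\<forall>k<m. s k = 0 \<or> w j k = 0))"
    by (simp add: sum_nonneg_eq_0_iff Ball_def)
  also have "\<dots> \<longleftrightarrow> \<not> overlap"
    unfolding overlap_def using r s by (auto simp: less_le)
  finally show ?thesis
    using 1 by (auto simp: less_le mtrace_sandwich intro!: sum_nonneg)
qed

text \<open>Between the bases \<open>U\<close> and \<open>V\<close>, the product of the supports has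
  entry \<open>(j,k)\<close> equal to that of \<open>U\<^sup>\<dagger> * V\<close>, kept only where
  both eigenvalues are positive. Without overlap all of them vanish.\<close>

lemma supp_mult_nonzero_imp_overlap:
  assumes "supp \<rho> * supp \<sigma> \<noteq> 0\<^sub>m m m"
  shows overlap
proof (rule ccontr)
  assume no: "\<not> overlap"
  let ?D = "mat_diag m (\<lambda>i. complex_of_real (r i powr 0))" and ?E = "mat_diag m (\<lambda>i. complex_of_real (s i powr 0))"
  have W: "U\<^sup>\<dagger> * V \<in> carrier_mat m m" by (simp add: mult_carrier_mat[of _ m m _ m])
  have "?D * (U\<^sup>\<dagger> * V) * ?E = 0\<^sub>m m m"
  proof (rule eq_matI)
    fix j k assume "j < dim_row (0\<^sub>m m m :: complex mat)" "k < dim_col (0\<^sub>m m m :: complex mat)"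
    then have jk: "j < m" "k < m" by auto
    have "(?D * (U\<^sup>\<dagger> * V) * ?E) $$ (j,k)
        = complex_of_real (r j powr 0) * (U\<^sup>\<dagger> * V) $$ (j,k) * complex_of_real (s k powr 0)"
      using jk unfolding mat_diag_mult_left[OF W] by (subst mat_diag_mult_right[of _ m]) (auto simp del: index_mult_mat)
    also have "\<dots> = 0"
      using no jk r[OF jk(1)] s[OF jk(2)] unfolding overlap_def w_def by (auto simp: less_le simp del: index_mult_mat)
    finally show "(?D * (U\<^sup>\<dagger> * V) * ?E) $$ (j,k) = 0\<^sub>m m m $$ (j,k)" using jk by simp
  qed (auto simp: mat_diag_def)
  then have "U * (?D * (U\<^sup>\<dagger> * V) * ?E) * V\<^sup>\<dagger> = 0\<^sub>m m m"
    using right_mult_zero_mat[OF Uc, of m] left_mult_zero_mat[OF adjoint_carrier[OF Vc], of m] by simp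
  moreover have "supp \<rho> * supp \<sigma> = U * (?D * (U\<^sup>\<dagger> * V) * ?E) * V\<^sup>\<dagger>"
    unfolding supp_def mpow_\<rho> mpow_\<sigma> wdiag_def
    by (simp add: assoc_mult_mat[of _ m m _ m _ m] mult_carrier_mat[of _ m m _ m])
  ultimately show False using assms by simp
qed

definition incl :: bool where
  "incl \<longleftrightarrow> loewner_le m (supp \<rho>) (supp \<sigma>)"

text \<open>Comparing the diagonal entries of both supports at \<open>j\<close> shows that the
  weights over the support of \<sigma> already sum to at least 1. The whole row sums to 1, so
  nothing is left for the kernel of \<sigma>.\<close>

lemma incl_weight_zero:
  assumes incl and jk: "j < m" "k < m" "0 < r j" "s k = 0"
  shows "w j k = 0"
proof -
  have "0 \<le> Re ((U\<^sup>\<dagger> * (supp \<sigma> - supp \<rho>) * U) $$ (j,j))"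
    using assms(1) jk(1) unfolding incl_def loewner_le_def by (intro psd_diag_index_nonneg) auto
  also have "(U\<^sup>\<dagger> * (supp \<sigma> - supp \<rho>) * U) $$ (j,j)
      = (U\<^sup>\<dagger> * supp \<sigma> * U) $$ (j,j) - (U\<^sup>\<dagger> * supp \<rho> * U) $$ (j,j)"
    by (rule conj_minus_index[OF _ _ _ jk(1)]) (simp_all add: supp_def)
  also have "(U\<^sup>\<dagger> * supp \<sigma> * U) $$ (j,j) = complex_of_real (\<Sum>k<m. s k powr 0 * w j k)"
    unfolding supp_def mpow_\<sigma> by (rule conj_wdiag_V_index[OF jk(1)])
  also have "U\<^sup>\<dagger> * supp \<rho> * U = mat_diag m (\<lambda>i. complex_of_real (r i powr 0))"
    by (rule unitary_conj_cancel[OF U]) (simp_all add: supp_def mpow_\<rho> wdiag_def)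
  also have "Re (complex_of_real (\<Sum>k<m. s k powr 0 * w j k) - mat_diag m (\<lambda>i. complex_of_real (r i powr 0)) $$ (j,j))
      = (\<Sum>k<m. s k powr 0 * w j k) - 1"
    using jk by (simp add: mat_diag_def del: of_real_sum of_real_mult)
  finally have "(\<Sum>k<m. w j k) \<le> (\<Sum>k<m. s k powr 0 * w j k)" using w_row_sum[OF jk(1)] by simp
  then have "(\<Sum>k<m. (1 - s k powr 0) * w j k) \<le> 0" by (simp add: left_diff_distrib sum_subtractf)
  moreover have nn: "0 \<le> (1 - s k powr 0) * w j k" for k by simp
  ultimately have "(\<Sum>k<m. (1 - s k powr 0) * w j k) = 0" by (simp add: antisym sum_nonneg)
  then have "\<forall>k\<in>{..<m}. (1 - s k powr 0) * w j k = 0"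
    using nn by (subst (asm) sum_nonneg_eq_0_iff) auto
  then show ?thesis using jk by (auto dest!: bspec[of _ _ k])
qed

text \<open>A row of weights with \<open>r j > 0\<close> sums to 1, so it has a nonzero weight,
  which must then sit on the support of \<sigma>.\<close>

lemma incl_imp_overlap:
  assumes incl "0 < (\<Sum>j<m. r j)"
  shows overlap
proof -
  have "\<not> (\<forall>j\<in>{..<m}. r j \<le> 0)" using assms(2) sum_nonpos[of "{..<m}" r] by fastforce
  then obtain j where j: "j < m" "0 < r j" by (auto simp: not_le)
  have "\<not> (\<forall>k\<in>{..<m}. w j k = 0)"
  proof
    assume "\<forall>k\<in>{..<m}. w j k = 0"
    then have "(\<Sum>k<m. w j k) = 0" by (rule sum.neutral)
    with w_row_sum[OF j(1)] show False by linarith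
  qed
  then obtain k where k: "k < m" "w j k \<noteq> 0" by blast
  have "0 < s k" using incl_weight_zero[OF assms(1) j(1) k(1) j(2)] s[OF k(1)] k(2) by fastforce
  moreover have "0 < w j k" using k(2) by (simp add: less_le)
  ultimately show ?thesis unfolding overlap_def using j k(1) by blast
qed

section \<open>Relative entropy in the eigenbases\<close>

abbreviation R :: real where "R \<equiv> \<Sum>j<m. r j"

abbreviation plog :: "real \<Rightarrow> real" where "plog x \<equiv> (if x > 0 then ln x else 0)"

text \<open>The diagonal entry of \<open>mlog \<rho> - mlog \<sigma>\<close> at eigenvector
  \<open>j\<close> of \<rho>; averaging it with the weights \<open>r j / R\<close> gives
  \<open>D1\<close> when \<open>incl\<close> holds.\<close>

definition rel :: "nat \<Rightarrow> real" where
  "rel j = plog (r j) - (\<Sum>k<m. plog (s k) * w j k)"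

lemma mtrace_\<rho>: "Re (mtrace \<rho>) = R"
  by (simp add: \<rho>_eq mtrace_wdiag[OF U])

lemma mtrace_rel: "Re (mtrace (\<rho> * (mlog \<rho> - mlog \<sigma>))) = (\<Sum>j<m. r j * rel j)"
proof -
  have L: "mlog \<rho> = wdiag m U (\<lambda>i. plog (r i))" "mlog \<sigma> = wdiag m V (\<lambda>i. plog (s i))"
    by (simp_all add: mlog_def matfun_\<rho> matfun_\<sigma>)
  then have c: "mlog \<rho> \<in> carrier_mat m m" "mlog \<sigma> \<in> carrier_mat m m" by simp_all
  then have c': "mlog \<rho> - mlog \<sigma> \<in> carrier_mat m m" "\<rho> * (mlog \<rho> - mlog \<sigma>) \<in> carrier_mat m m"
    using psd_carrier[OF \<rho>] by (auto intro!: mult_carrier_mat minus_carrier_mat)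
  have "(U\<^sup>\<dagger> * (\<rho> * (mlog \<rho> - mlog \<sigma>)) * U) $$ (j,j) = complex_of_real (r j * rel j)" if j: "j < m" for j
  proof -
    have "(U\<^sup>\<dagger> * (\<rho> * (mlog \<rho> - mlog \<sigma>)) * U) $$ (j,j)
        = complex_of_real (r j) * ((U\<^sup>\<dagger> * mlog \<rho> * U) $$ (j,j) - (U\<^sup>\<dagger> * mlog \<sigma> * U) $$ (j,j))"
      by (subst \<rho>_eq, subst conj_wdiag_left_index[OF U c'(1) j], subst conj_minus_index[OF Uc c j]) (rule refl)
    also have "U\<^sup>\<dagger> * mlog \<rho> * U = mat_diag m (\<lambda>i. complex_of_real (plog (r i)))"
      by (rule unitary_conj_cancel[OF U]) (simp_all add: L wdiag_def)
    also have "(U\<^sup>\<dagger> * mlog \<sigma> * U) $$ (j,j) = complex_of_real (\<Sum>k<m. plog (s k) * w j k)"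
      unfolding L by (rule conj_wdiag_V_index[OF j])
    also have "mat_diag m (\<lambda>i. complex_of_real (plog (r i))) $$ (j,j) = complex_of_real (plog (r j))"
      using j by (simp add: mat_diag_def)
    finally show ?thesis by (simp only: rel_def of_real_mult of_real_diff)
  qed
  then show ?thesis
    unfolding mtrace_conj[OF U c'(2)] by (simp del: of_real_mult index_mult_mat)
qed

text \<open>\<open>Q\<^sub>\<alpha>\<^sub>,\<^sub>z\<close> without the value \<open>\<infinity>\<close>: with generalized inverse powers the formula makes sense, and is
  log-convex, for all real \<open>\<alpha>\<close>.\<close>

definition q :: "real \<Rightarrow> real \<Rightarrow> real" where
  "q \<alpha> z = trpow (sandwich (\<alpha> / (2 * z)) ((1 - \<alpha>) / z)) z"

lemma q_pos: "overlap \<Longrightarrow> 0 < q \<alpha> z"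
  unfolding q_def by (simp add: trpow_pos_iff[OF sandwich_psd] mtrace_sandwich_pos_iff)

lemma q_zero: "\<not> overlap \<Longrightarrow> q \<alpha> z = 0"
  using trpow_nonneg[OF sandwich_psd] trpow_pos_iff[OF sandwich_psd] mtrace_sandwich_pos_iff
  unfolding q_def by (metis less_le)

text \<open>Both exponents are affine in \<alpha>, so along a segment every scalar power is
  dominated by the sum of its endpoint values. This bounds the trace of the sandwich, hence the
  trace of its power.\<close>

lemma q_bounded:
  assumes z: "0 < z"
  shows "\<exists>M. \<forall>u. 0 \<le> u \<and> u \<le> 1 \<longrightarrow> q (u * x + (1 - u) * y) z \<le> M"
proof (intro exI allI impI)
  fix u :: real assume u: "0 \<le> u \<and> u \<le> 1"
  define \<alpha> where "\<alpha> = u * x + (1 - u) * y"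
  let ?B = "\<Sum>j<m. (r j powr (x / z) + r j powr (y / z))
      * (\<Sum>k<m. (s k powr ((1 - x) / z) + s k powr ((1 - y) / z)) * w j k)"
  have e: "2 * (\<alpha> / (2 * z)) = u * (x / z) + (1 - u) * (y / z)"
    "(1 - \<alpha>) / z = u * ((1 - x) / z) + (1 - u) * ((1 - y) / z)"
    using z by (simp_all add: \<alpha>_def field_simps)
  have "Re (mtrace (sandwich (\<alpha> / (2 * z)) ((1 - \<alpha>) / z))) \<le> ?B"
    unfolding mtrace_sandwich e using u r s
    by (intro sum_mono mult_mono powr_convex_combination_le) (auto intro!: sum_nonneg)
  moreover have "0 \<le> Re (mtrace (sandwich (\<alpha> / (2 * z)) ((1 - \<alpha>) / z)))"
    unfolding mtrace_sandwich by (intro sum_nonneg mult_nonneg_nonneg) auto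
  ultimately have "m * Re (mtrace (sandwich (\<alpha> / (2 * z)) ((1 - \<alpha>) / z))) powr z \<le> m * ?B powr z"
    using z by (intro mult_left_mono powr_mono2) auto
  with trpow_le_mtrace[OF sandwich_psd z] show "q (u * x + (1 - u) * y) z \<le> m * ?B powr z"
    unfolding q_def \<alpha>_def by (rule order_trans)
qed

lemma q_log_convex:
  assumes overlap and z: "0 < z" and "0 \<le> \<theta>" "\<theta> \<le> 1"
  shows "q (\<theta> * x + (1 - \<theta>) * y) z \<le> q x z powr \<theta> * q y z powr (1 - \<theta>)"
proof (rule midpoint_log_convex[of "\<lambda>\<alpha>. q \<alpha> z"])
  fix x y :: real
  have "(x + y) / 2 / (2 * z) = (x / (2 * z) + y / (2 * z)) / 2" "(1 - (x + y) / 2) / z = ((1 - x) / z + (1 - y) / z) / 2"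
    using z by (simp_all add: field_simps)
  then show "(q ((x + y) / 2) z)\<^sup>2 \<le> q x z * q y z"
    unfolding q_def by (simp only: trpow_sandwich_midpoint[OF z])
qed (use assms q_pos q_bounded[OF z] in auto)

lemma q_one_le:
  assumes "0 < z"
  shows "q 1 z \<le> R"
  using trpow_sandwich_le[OF assms] by (simp add: q_def)

text \<open>Jensen's inequality for the exponential is used over \<open>j\<close> with the
  probabilities \<open>r j / R\<close> and over \<open>k\<close> with the weights
  \<open>w j k\<close>. The result is a sum of powers of diagonal entries of the sandwich, which
  Peierls' inequality bounds by its trace of powers.\<close>

lemma q_lower_bound_ge_1:
  assumes incl and R: "0 < R" and z: "1 \<le> z"
  shows "R * exp ((\<alpha> - 1) * ((\<Sum>j<m. r j * rel j) / R)) \<le> q \<alpha> z"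
proof -
  let ?t = "(1 - \<alpha>) / z"
  have "R * exp ((\<alpha> - 1) * ((\<Sum>j<m. r j * rel j) / R)) = R * exp (\<Sum>j<m. r j / R * ((\<alpha> - 1) * rel j))"
    by (simp add: sum_distrib_left sum_divide_distrib mult_ac)
  also have "\<dots> \<le> R * (\<Sum>j<m. r j / R * exp ((\<alpha> - 1) * rel j))"
  proof (rule mult_left_mono)
    have "{..<m} \<noteq> {}" using R by auto
    moreover have "(\<Sum>j<m. r j / R) = 1" using R by (simp flip: sum_divide_distrib)
    ultimately show "exp (\<Sum>j<m. r j / R * ((\<alpha> - 1) * rel j)) \<le> (\<Sum>j<m. r j / R * exp ((\<alpha> - 1) * rel j))"
      using convex_on_sum[OF _ _ exp_convex, of "{..<m}" "\<lambda>j. r j / R" "\<lambda>j. (\<alpha> - 1) * rel j"] r R by auto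
  qed (use R in simp)
  also have "\<dots> = (\<Sum>j<m. r j * exp ((\<alpha> - 1) * rel j))"
    using R by (simp add: sum_distrib_left)
  also have "\<dots> \<le> (\<Sum>j<m. (r j powr (2 * (\<alpha> / (2 * z))) * (\<Sum>k<m. s k powr ?t * w j k)) powr z)"
  proof (rule sum_mono)
    fix j assume "j \<in> {..<m}"
    then have j: "j < m" by simp
    let ?p = "\<Sum>k<m. plog (s k) * w j k" and ?a = "\<Sum>k<m. s k powr ?t * w j k"
    show "r j * exp ((\<alpha> - 1) * rel j) \<le> (r j powr (2 * (\<alpha> / (2 * z))) * ?a) powr z"
    proof (cases "r j = 0")
      case False
      with r[OF j] have rj: "0 < r j" by simp
      have "{..<m} \<noteq> {}" using j by auto
      then have "exp (\<Sum>k<m. w j k * (?t * plog (s k))) \<le> (\<Sum>k<m. w j k * exp (?t * plog (s k)))"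
        using convex_on_sum[OF _ _ exp_convex w_row_sum[OF j], of "\<lambda>k. ?t * plog (s k)"] by auto
      \<comment> \<open>For \<open>s k = 0\<close> the left factor is \<open>exp 0 = 1\<close> but
        the right power is 0; the terms agree only because the inclusion of supports makes the
        weight vanish.\<close>
      also have "\<dots> = ?a"
      proof (rule sum.cong)
        fix k assume "k \<in> {..<m}"
        then show "w j k * exp (?t * plog (s k)) = s k powr ?t * w j k"
          using incl_weight_zero[OF assms(1) j _ rj, of k] s[of k]
          by (cases "s k = 0") (auto simp: powr_def)
      qed simp
      also have "(\<Sum>k<m. w j k * (?t * plog (s k))) = ?t * ?p"
        by (simp add: sum_distrib_left mult_ac)
      finally have a: "exp (?t * ?p) \<le> ?a" .
      have "r j * exp ((\<alpha> - 1) * rel j) = exp (\<alpha> * ln (r j)) * exp ((1 - \<alpha>) * ?p)"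
      proof -
        have "r j * exp ((\<alpha> - 1) * rel j) = exp (ln (r j) + (\<alpha> - 1) * rel j)" using rj by (simp add: exp_add)
        also have "ln (r j) + (\<alpha> - 1) * rel j = \<alpha> * ln (r j) + (1 - \<alpha>) * ?p"
          using rj by (simp add: rel_def algebra_simps)
        finally show ?thesis by (simp only: exp_add)
      qed
      also have "\<dots> = r j powr \<alpha> * exp (?t * ?p) powr z"
        using rj z by (simp add: powr_def)
      also have "\<dots> \<le> r j powr \<alpha> * ?a powr z"
        using a z by (intro mult_left_mono powr_mono2) auto
      also have "\<dots> = (r j powr (2 * (\<alpha> / (2 * z))) * ?a) powr z"
        using z by (simp add: powr_mult powr_powr sum_nonneg)
      finally show ?thesis .
    qed simp
  qed
  also have "\<dots> = (\<Sum>j<m. Re ((U\<^sup>\<dagger> * sandwich (\<alpha> / (2 * z)) ?t * U) $$ (j,j)) powr z)"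
    by (intro sum.cong) (auto simp: sandwich_diag_index simp del: index_mult_mat of_real_mult of_real_sum)
  also have "\<dots> \<le> q \<alpha> z" unfolding q_def by (rule peierls[OF sandwich_psd U z])
  finally show ?thesis .
qed

text \<open>This says that \<open>D\<^sub>1\<close> is a subgradient of \<open>ln Q\<^sub>\<alpha>\<^sub>,\<^sub>z\<close> at \<open>\<alpha> = 1\<close>. Since \<open>Q\<^sub>\<alpha>\<^sub>,\<^sub>2\<^sub>z \<le> Q\<^sub>\<alpha>\<^sub>,\<^sub>z\<close>, repeated doubling
  of \<open>z\<close> leads to the case \<open>z \<ge> 1\<close>.\<close>

lemma q_lower_bound:
  assumes incl and R: "0 < R" and z: "0 < z"
  shows "R * exp ((\<alpha> - 1) * ((\<Sum>j<m. r j * rel j) / R)) \<le> q \<alpha> z"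
proof -
  obtain n :: nat where "1 / z < 2 ^ n" using real_arch_pow[of 2 "1 / z"] by auto
  then have "1 \<le> 2 ^ n * z" using z by (simp add: divide_simps)
  then show ?thesis using z
  proof (induction n arbitrary: z)
    case 0
    then show ?case using q_lower_bound_ge_1[OF assms(1) R] by simp
  next
    case (Suc n)
    have "R * exp ((\<alpha> - 1) * ((\<Sum>j<m. r j * rel j) / R)) \<le> q \<alpha> (2 * z)"
      using Suc.prems by (intro Suc.IH) (auto simp: mult_ac)
    also have "\<dots> \<le> q \<alpha> z"
    proof -
      have "2 * (\<alpha> / (2 * (2 * z))) = \<alpha> / (2 * z)" "2 * ((1 - \<alpha>) / (2 * z)) = (1 - \<alpha>) / z"
        using Suc.prems(2) by (simp_all add: field_simps)
      with trpow_sandwich_double[OF Suc.prems(2), of "\<alpha> / (2 * (2 * z))" "(1 - \<alpha>) / (2 * z)"]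
      show ?thesis unfolding q_def by (simp only:)
    qed
    finally show ?case .
  qed
qed

end

section \<open>Log-convexity and monotonicity\<close>

context psd_pair
begin

lemma Qaz_eq: "\<alpha> \<le> 1 \<or> incl \<Longrightarrow> Qaz m \<alpha> z \<rho> \<sigma> = ereal (q \<alpha> z)"
  by (auto simp: Qaz_def q_def trpow_def sandwich_def incl_def)

lemma Qaz_top: "\<not> incl \<Longrightarrow> 1 < \<alpha> \<Longrightarrow> Qaz m \<alpha> z \<rho> \<sigma> = \<infinity>"
  by (auto simp: Qaz_def incl_def)

text \<open>Infinity times 0 is 0 in \<open>ereal\<close>, so a factor next to an infinite one has
  to be strictly positive for the product to be infinite.\<close>

lemma epowr_Qaz_pos:
  assumes overlap
  shows "0 < epowr (Qaz m \<alpha> z \<rho> \<sigma>) \<theta>"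
  using q_pos[OF assms, of \<alpha> z] Qaz_eq[of \<alpha> z] Qaz_top[of \<alpha> z]
  by (cases "\<alpha> \<le> 1 \<or> incl") (auto simp: epowr_def)

text \<open>Either all three values are finite and the real statement applies, or one of the two
  endpoints carries an infinite value and the right side is infinite.\<close>

lemma Qaz_log_convex:
  assumes ov: overlap and z: "0 < z" and \<theta>: "0 < \<theta>" "\<theta> < 1"
  shows "Qaz m (\<theta> * x + (1 - \<theta>) * y) z \<rho> \<sigma>
    \<le> epowr (Qaz m x z \<rho> \<sigma>) \<theta> * epowr (Qaz m y z \<rho> \<sigma>) (1 - \<theta>)"
proof (cases "incl \<or> (x \<le> 1 \<and> y \<le> 1)")
  case True
  have "\<theta> * x + (1 - \<theta>) * y \<le> 1" if "x \<le> 1" "y \<le> 1"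
    using convex_bound_le[OF that, of \<theta> "1 - \<theta>"] \<theta> by simp
  with True have "\<theta> * x + (1 - \<theta>) * y \<le> 1 \<or> incl" "x \<le> 1 \<or> incl" "y \<le> 1 \<or> incl" by blast+
  then show ?thesis
    using q_log_convex[OF ov z, of \<theta> x y] \<theta> by (simp add: Qaz_eq epowr_def)
next
  case False
  then have "Qaz m x z \<rho> \<sigma> = \<infinity> \<or> Qaz m y z \<rho> \<sigma> = \<infinity>"
    using Qaz_top[of x z] Qaz_top[of y z] by (auto simp: not_le)
  then consider "Qaz m x z \<rho> \<sigma> = \<infinity>" | "Qaz m y z \<rho> \<sigma> = \<infinity>" by blast
  then have "epowr (Qaz m x z \<rho> \<sigma>) \<theta> * epowr (Qaz m y z \<rho> \<sigma>) (1 - \<theta>) = \<infinity>"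
  proof cases
    case 1
    then show ?thesis using epowr_Qaz_pos[OF ov, of y z "1 - \<theta>"] by (simp add: epowr_def)
  next
    case 2
    then show ?thesis using epowr_Qaz_pos[OF ov, of x z \<theta>] by (simp add: epowr_def)
  qed
  then show ?thesis by (simp only: ereal_less_eq(1))
qed

section \<open>Monotonicity of the divergences\<close>

lemma Daz_eq:
  assumes ov: overlap and R: "0 < R" and \<alpha>: "\<alpha> \<noteq> 1" "\<alpha> \<le> 1 \<or> incl"
  shows "Daz m \<alpha> z \<rho> \<sigma> = ereal ((ln (q \<alpha> z) - ln R) / (\<alpha> - 1))"
proof -
  have "elog (ereal (q \<alpha> z) / ereal R) = ereal (ln (q \<alpha> z) - ln R)"
    using q_pos[OF ov, of \<alpha> z] R by (simp add: elog_def ln_div not_le)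
  then show ?thesis using \<alpha> by (simp add: Daz_def Qaz_eq mtrace_\<rho>)
qed

lemma Daz_top:
  assumes R: "0 < R" and "\<not> incl" and "1 < \<alpha> \<or> \<alpha> = 1 \<or> \<not> overlap"
  shows "Daz m \<alpha> z \<rho> \<sigma> = \<infinity>"
proof -
  consider "\<alpha> = 1" | "1 < \<alpha>" | "\<alpha> < 1" "\<not> overlap" using assms(3) by linarith
  then show ?thesis
  proof cases
    case 1
    then show ?thesis using assms by (simp add: Daz_def D1_def umegaki_def incl_def mtrace_\<rho>)
  next
    case 2
    then show ?thesis using R Qaz_top[OF assms(2) 2] by (simp add: Daz_def elog_def mtrace_\<rho>)
  next
    \<comment> \<open>Here \<open>q\<close> is 0, so \<open>elog\<close> gives minus infinity, and
      the negative factor \<open>1 / (\<alpha> - 1)\<close> turns this into plus infinity.\<close>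
    case 3
    then show ?thesis using R by (simp add: Daz_def elog_def mtrace_\<rho> Qaz_eq q_zero zero_ereal_def)
  qed
qed

lemma D1_eq:
  assumes "0 < R" incl
  shows "D1 m \<rho> \<sigma> = ereal ((\<Sum>j<m. r j * rel j) / R)"
  using assms by (simp add: D1_def umegaki_def incl_def mtrace_\<rho> mtrace_rel)

text \<open>Log-convexity on the segment from 1 to \<open>x\<close>, with the value at 1 replaced by
  its upper bound \<open>R\<close>. It compares slopes of chords through the point at 1 of height
  \<open>ln R\<close>, and these slopes are the divergences.\<close>

lemma ln_q_scaled:
  assumes ov: overlap and R: "0 < R" and z: "0 < z" and \<theta>: "0 \<le> \<theta>" "\<theta> \<le> 1"
  shows "ln (q (\<theta> * x + (1 - \<theta>)) z) - ln R \<le> \<theta> * (ln (q x z) - ln R)"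
proof -
  note pos = q_pos[OF ov]
  have "q (\<theta> * x + (1 - \<theta>)) z \<le> q x z powr \<theta> * q 1 z powr (1 - \<theta>)"
    using q_log_convex[OF ov z \<theta>, of x 1] by simp
  also have "\<dots> \<le> q x z powr \<theta> * R powr (1 - \<theta>)"
    using q_one_le[OF z] pos[of 1 z] \<theta> by (intro mult_left_mono powr_mono2) auto
  finally have "ln (q (\<theta> * x + (1 - \<theta>)) z) \<le> ln (q x z powr \<theta> * R powr (1 - \<theta>))"
    using pos[of x z] pos[of "\<theta> * x + (1 - \<theta>)" z] R by (subst ln_le_cancel_iff) auto
  also have "\<dots> = \<theta> * ln (q x z) + (1 - \<theta>) * ln R"
    using pos[of x z] R by (simp add: ln_mult ln_powr)
  finally show ?thesis by (simp add: algebra_simps)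
qed

lemma Daz_mono_below_1:
  assumes ov: overlap and R: "0 < R" and z: "0 < z" and "\<alpha> \<le> \<beta>" "\<beta> < 1"
  shows "Daz m \<alpha> z \<rho> \<sigma> \<le> Daz m \<beta> z \<rho> \<sigma>"
proof -
  \<comment> \<open>This weight writes \<beta> as a convex combination of \<alpha> and 1; division
    by the negative \<open>\<beta> - 1\<close> later reverses the inequality.\<close>
  define \<theta> where "\<theta> = (1 - \<beta>) / (1 - \<alpha>)"
  have "\<theta> * (1 - \<alpha>) = 1 - \<beta>" using assms(4,5) by (simp add: \<theta>_def)
  then have \<theta>': "\<theta> * \<alpha> + (1 - \<theta>) = \<beta>" by (simp add: right_diff_distrib)
  have \<theta>: "0 \<le> \<theta>" "\<theta> \<le> 1" using assms(4,5) by (simp_all add: \<theta>_def)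
  have "ln (q \<beta> z) - ln R \<le> \<theta> * (ln (q \<alpha> z) - ln R)"
    using ln_q_scaled[OF ov R z \<theta>, of \<alpha>] by (simp only: \<theta>')
  then have "\<theta> * (ln (q \<alpha> z) - ln R) / (\<beta> - 1) \<le> (ln (q \<beta> z) - ln R) / (\<beta> - 1)"
    using assms(5) by (intro divide_right_mono_neg) auto
  moreover have "\<theta> * x / (\<beta> - 1) = x / (\<alpha> - 1)" for x
    using assms(4,5) by (simp add: \<theta>_def divide_simps) (simp add: algebra_simps)
  ultimately show ?thesis using assms(4,5) by (simp add: Daz_eq[OF ov R])
qed

lemma Daz_mono_above_1:
  assumes incl and R: "0 < R" and z: "0 < z" and "1 < \<alpha>" "\<alpha> \<le> \<beta>"
  shows "Daz m \<alpha> z \<rho> \<sigma> \<le> Daz m \<beta> z \<rho> \<sigma>"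
proof -
  have ov: overlap by (rule incl_imp_overlap[OF assms(1) R])
  \<comment> \<open>Above 1 the roles are exchanged: the smaller index \<alpha> is a convex
    combination of \<beta> and 1.\<close>
  define \<theta> where "\<theta> = (\<alpha> - 1) / (\<beta> - 1)"
  have \<theta>: "0 \<le> \<theta>" "\<theta> \<le> 1" using assms(4,5) by (simp_all add: \<theta>_def)
  have "\<theta> * (\<beta> - 1) = \<alpha> - 1" using assms(4,5) by (simp add: \<theta>_def)
  then have \<theta>': "\<theta> * \<beta> + (1 - \<theta>) = \<alpha>" by (simp add: right_diff_distrib)
  have "ln (q \<alpha> z) - ln R \<le> \<theta> * (ln (q \<beta> z) - ln R)"
    using ln_q_scaled[OF ov R z \<theta>, of \<beta>] by (simp only: \<theta>')
  then have "(ln (q \<alpha> z) - ln R) / (\<alpha> - 1) \<le> \<theta> * (ln (q \<beta> z) - ln R) / (\<alpha> - 1)"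
    using assms(4) by (intro divide_right_mono) auto
  moreover have "\<theta> * x / (\<alpha> - 1) = x / (\<beta> - 1)" for x
    using assms(4,5) by (simp add: \<theta>_def divide_simps)
  ultimately show ?thesis using assms(1,4,5) by (simp add: Daz_eq[OF ov R])
qed

lemma ln_q_lower_bound:
  assumes incl "0 < R" "0 < z"
  shows "(\<alpha> - 1) * ((\<Sum>j<m. r j * rel j) / R) \<le> ln (q \<alpha> z) - ln R"
proof -
  have "ln (R * exp ((\<alpha> - 1) * ((\<Sum>j<m. r j * rel j) / R))) \<le> ln (q \<alpha> z)"
    using q_lower_bound[OF assms, of \<alpha>] assms(2) q_pos[OF incl_imp_overlap[OF assms(1,2)], of \<alpha> z]
    by (subst ln_le_cancel_iff) auto
  then show ?thesis using assms(2) by (simp add: ln_mult)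
qed

lemma Daz_le_D1:
  assumes R: "0 < R" and z: "0 < z" and \<alpha>: "\<alpha> < 1"
  shows "Daz m \<alpha> z \<rho> \<sigma> \<le> D1 m \<rho> \<sigma>"
proof (cases incl)
  case True
  have "(ln (q \<alpha> z) - ln R) / (\<alpha> - 1) \<le> (\<Sum>j<m. r j * rel j) / R"
    using ln_q_lower_bound[OF True R z, of \<alpha>] \<alpha> by (simp add: neg_divide_le_eq mult.commute)
  then show ?thesis
    using \<alpha> by (simp add: Daz_eq[OF incl_imp_overlap[OF True R] R] D1_eq[OF R True])
next
  case False
  then show ?thesis using Daz_top[OF R False, of 1] by (simp add: Daz_def)
qed

lemma D1_le_Daz:
  assumes R: "0 < R" and z: "0 < z" and \<alpha>: "1 < \<alpha>"
  shows "D1 m \<rho> \<sigma> \<le> Daz m \<alpha> z \<rho> \<sigma>"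
proof (cases incl)
  case True
  have "(\<Sum>j<m. r j * rel j) / R \<le> (ln (q \<alpha> z) - ln R) / (\<alpha> - 1)"
    using ln_q_lower_bound[OF True R z, of \<alpha>] \<alpha> by (simp add: pos_le_divide_eq mult.commute)
  then show ?thesis
    using \<alpha> True by (simp add: Daz_eq[OF incl_imp_overlap[OF True R] R] D1_eq[OF R True])
next
  case False
  then show ?thesis using Daz_top[OF R False, of \<alpha>] \<alpha> by simp
qed

lemma Daz_mono:
  assumes R: "0 < R" and z: "0 < z" and le: "\<alpha> \<le> \<beta>"
  shows "Daz m \<alpha> z \<rho> \<sigma> \<le> Daz m \<beta> z \<rho> \<sigma>"
proof -
  have D1: "Daz m 1 z \<rho> \<sigma> = D1 m \<rho> \<sigma>" by (simp add: Daz_def)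
  consider "\<alpha> = \<beta>" | "\<beta> < 1" | "\<alpha> < 1" "\<beta> = 1" | "\<alpha> < 1" "1 < \<beta>" | "\<alpha> = 1" "1 < \<beta>" | "1 < \<alpha>"
    using le by linarith
  then show ?thesis
  proof cases
    case 2
    show ?thesis
    proof (cases overlap)
      case True
      then show ?thesis using Daz_mono_below_1[OF _ R z le 2] by blast
    next
      case False
      \<comment> \<open>Without overlap the supports cannot be included either, so the right-hand
        divergence is already infinite.\<close>
      then show ?thesis using Daz_top[OF R, of \<beta>] incl_imp_overlap[OF _ R] by fastforce
    qed
  next
    case 3
    then show ?thesis using Daz_le_D1[OF R z] D1 by simp
  next
    case 4
    then show ?thesis using Daz_le_D1[OF R z] D1_le_Daz[OF R z] by (blast intro: order_trans)
  next
    case 5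
    then show ?thesis using D1_le_Daz[OF R z] D1 by simp
  next
    case 6
    show ?thesis
    proof (cases incl)
      case True
      then show ?thesis using Daz_mono_above_1[OF _ R z 6 le] by blast
    next
      case False
      then show ?thesis using Daz_top[OF R False, of \<beta>] 6 le by simp
    qed
  qed simp
qed

lemma R_pos:
  assumes "\<rho> \<noteq> 0\<^sub>m m m"
  shows "0 < R"
proof (rule ccontr)
  assume "\<not> 0 < R"
  moreover have "0 \<le> R" using r by (auto intro!: sum_nonneg)
  ultimately have "R = 0" by simp
  then have "\<forall>j\<in>{..<m}. r j = 0" using r by (subst (asm) sum_nonneg_eq_0_iff) auto
  then have "\<rho> = wdiag m U (\<lambda>_. 0)" unfolding \<rho>_eq by (intro wdiag_cong) auto
  also have "\<dots> = 0\<^sub>m m m"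
    using carrier_matD[OF wdiag_carrier[OF Uc]] by (intro eq_matI) (auto simp: wdiag_index)
  finally show False using assms by simp
qed

end

theorem theorem3p1:
  fixes m :: nat and \<rho> \<sigma> :: "complex mat"
  assumes "psd m \<rho>" and "psd m \<sigma>" and "\<rho> \<noteq> 0\<^sub>m m m"
  shows
    "(supp \<rho> * supp \<sigma> \<noteq> 0\<^sub>m m m \<longrightarrow>
       (\<forall>z>0. \<forall>\<alpha>1 \<ge> 0. \<forall>\<alpha>2 \<ge> 0. \<forall>\<theta>. 0 < \<theta> \<and> \<theta> < 1 \<longrightarrow>
          Qaz m (\<theta> * \<alpha>1 + (1 - \<theta>) * \<alpha>2) z \<rho> \<sigma>
            \<le> epowr (Qaz m \<alpha>1 z \<rho> \<sigma>) \<theta> * epowr (Qaz m \<alpha>2 z \<rho> \<sigma>) (1 - \<theta>)))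
     \<and> (\<forall>z>0. \<forall>\<alpha> \<ge> 0. \<forall>\<beta>. \<alpha> \<le> \<beta> \<longrightarrow> Daz m \<alpha> z \<rho> \<sigma> \<le> Daz m \<beta> z \<rho> \<sigma>)
     \<and> (\<forall>z>0. \<forall>\<alpha> \<alpha>'. 0 \<le> \<alpha> \<and> \<alpha> < 1 \<and> 1 < \<alpha>' \<longrightarrow>
          Daz m \<alpha> z \<rho> \<sigma> \<le> D1 m \<rho> \<sigma> \<and> D1 m \<rho> \<sigma> \<le> Daz m \<alpha>' z \<rho> \<sigma>)"
proof -
  obtain U r where U: "unitary m U" "\<rho> = wdiag m U r" "\<And>i. i < m \<Longrightarrow> 0 \<le> r i"
    "\<And>f. matfun f \<rho> = wdiag m U (\<lambda>i. f (r i))" using psd_decomp[OF assms(1)] by metis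
  obtain V s where V: "unitary m V" "\<sigma> = wdiag m V s" "\<And>i. i < m \<Longrightarrow> 0 \<le> s i"
    "\<And>f. matfun f \<sigma> = wdiag m V (\<lambda>i. f (s i))" using psd_decomp[OF assms(2)] by metis
  interpret psd_pair m \<rho> \<sigma> U V r s
    by unfold_locales (fact assms U V)+
  show ?thesis
    using Qaz_log_convex[OF supp_mult_nonzero_imp_overlap] Daz_mono[OF R_pos[OF assms(3)]]
      Daz_le_D1[OF R_pos[OF assms(3)]] D1_le_Daz[OF R_pos[OF assms(3)]]
    by blast
qed

end
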